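(* Let $m,n\ge0$ and $a_1,\dots,a_{m+n}\in\Sigma$. Then there is an inclusion of presheaves \[\mathcal{L}\big(\mathrm{COSK}^\Sigma(\square[a_1,\dots,a_m]_{\leq 1}\times_\Sigma\square[a_{m+1},\dots,a_{m+n}]_{\leq 1})\big)\subset \mathrm{cosk}_1^{\widehat{\square},\Sigma}\big(\widehat{\square}[a_1,\dots,a_m]_{\leq 1}\times_\Sigma\widehat{\square}[a_{m+1},\dots,a_{m+n}]_{\leq 1}\big).\] Moreover, when $\Sigma\setminus\{\tau\}$ is non-empty, there exist two labelled cubes $\square[a_1,\dots,a_m]$, $\square[a_{m+1},\dots,a_{m+n}]$ for which this inclusion is strict.
   Context: Cubes and categories of cubes: $[0]=\{()\}$, $[n]=\{0,1\}^n$ with the product order; face maps $\delta_i^\alpha:[n-1]\to[n]$ insert $\alpha$ at position $i$; $\square$ is the category with objects $[n]$ generated by face maps; a map $[m]\to[n]$ is adjacency-preserving if strictly increasing and it sends pairs at Hamming distance $1$ to pairs at Hamming distance $1$; $\widehat\square$ is the category with objects $[n]$, $n\ge0$, and all adjacency-preserving maps. Presheaves on $\square$ (resp. $\widehat\square$) are precubical sets (resp. transverse symmetric precubical sets); $\square[p]=\square(-,[p])$, $\widehat\square[p]=\widehat\square(-,[p])$; $K_{\le1}$ is truncation to dimensions $\le1$. $\mathcal L$ is the left adjoint of the restriction functor from transverse symmetric precubical sets to precubical sets. Labels: $\Sigma$ is a non-empty set with a distinguished element $\tau$; $\Sigma\setminus\{\tau\}$ carries an involution $a\mapsto\bar a$.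 $!\Sigma$ is the precubical set with $(!\Sigma)_0=\{()\}$, $(!\Sigma)_n=\Sigma^n$, $\partial_i^0=\partial_i^1$ deleting the $i$-th letter. $\mathrm{sh}$ is the left adjoint of the inclusion into transverse symmetric precubical sets of the full subcategory of those $X$ in which two $p$-cubes ($p\ge2$) with the same boundary are equal. Labelled precubical sets are precubical sets over $!\Sigma$; labelled transverse symmetric precubical sets are transverse symmetric precubical sets over $\mathrm{sh}\mathcal L(!\Sigma)$; $\mathcal L$ sends $K\to!\Sigma$ to $\mathcal L(K)\to\mathcal L(!\Sigma)\to\mathrm{sh}\mathcal L(!\Sigma)$. $\square[a_1,\dots,a_n]$ is $\square[n]\to!\Sigma$ sending $\mathrm{id}_{[n]}$ to $(a_1,\dots,a_n)$; $\widehat\square[a_1,\dots,a_n]=\mathcal L(\square[a_1,\dots,a_n])$. A $1$-dimensional labelled (transverse symmetric or not) precubical set amounts to sets $K_0,K_1$, maps $\partial_1^0,\partial_1^1:K_1\to K_0$ and $\ell:K_1\to\Sigma$. $\mathrm{cosk}_1^{\widehat\square,\Sigma}$ (resp. $\mathrm{cosk}_1^{\square,\Sigma}$) is the right adjoint of truncation $K\mapsto K_{\le1}$ from labelled transverse symmetric precubical sets (resp. labelled precubical sets) to $1$-dimensional ones. Fibered product: for $1$-dimensional labelled $K,L$, $K\times_\Sigma L$ has $0$-cubes $K_0\times L_0$, $1$-cubes $(K_1\times L_0)\sqcup(K_0\times L_1)\sqcup\{(x,y)\in K_1\times L_1:\overline{\ell(x)}=\ell(y)\}$, faces componentwise on the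 $1$-cube components, labels $\ell(x,y)=\ell(x)$, $\ell(y)$, resp. $\tau$ in the three cases. Labelled directed coskeleton: for a $1$-dimensional labelled precubical set $K$ with $K_0$ identified with $[p]$ (here $[m]\times[n]=[m+n]$), and an $n'$-cube $x$ of $\mathrm{cosk}_1^{\square,\Sigma}(K)$, let $x_0:[n']\cong\square([0],[n'])\to[p]$ be the induced map on vertices; $x_0$ is non-twisted if $x_0=\psi\circ\phi$ with $\psi:[q]\to[p]$ in $\square$ and $\phi(\epsilon_1,\dots,\epsilon_{n'})=(\epsilon_{i_1},\dots,\epsilon_{i_q})$ where $\{1,\dots,n'\}\subset\{i_1,\dots,i_q\}$ and the first occurrence of $\epsilon_i$ precedes the first occurrence of $\epsilon_{i+1}$. $\mathrm{COSK}^\Sigma(K)$ is the sub-object of $\mathrm{cosk}_1^{\square,\Sigma}(K)$ with the same cubes of dimension $\le1$ and, in dimensions $\ge2$, exactly the cubes $x$ with $x_0$ non-twisted. *)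

theory Defs
  imports Main
begin

type_synonym vert = "bool list"
type_synonym cmap = "bool list \<Rightarrow> bool list"

definition verts :: "nat \<Rightarrow> vert set" where
  "verts n = {v. length v = n}"

definition leq :: "vert \<Rightarrow> vert \<Rightarrow> bool" where
  "leq x y \<longleftrightarrow> length x = length y \<and> (\<forall>i<length x. x!i \<longrightarrow> y!i)"

definition hamming :: "vert \<Rightarrow> vert \<Rightarrow> nat" where
  "hamming x y = card {i. i < length x \<and> x!i \<noteq> y!i}"

text \<open>A map [m] -> [n] is represented by a function on bool lists that is
  normalised to [] outside verts m (so that representations are unique).\<close>
definition is_map :: "nat \<Rightarrow> nat \<Rightarrow> cmap \<Rightarrow> bool" where
  "is_map m n f \<longleftrightarrow> (\<forall>x\<in>verts m. f x \<in> verts n) \<and> (\<forall>x. x \<notin> verts m \<longrightarrow> f x = [])"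

definition cmp :: "nat \<Rightarrow> cmap \<Rightarrow> cmap \<Rightarrow> cmap" where
  "cmp m g f = (\<lambda>x. if x \<in> verts m then g (f x) else [])"

definition idm :: "nat \<Rightarrow> cmap" where
  "idm n = (\<lambda>x. if x \<in> verts n then x else [])"

text \<open>face map delta_i^alpha : [n-1] -> [n], 1 <= i <= n, inserting alpha at position i\<close>
definition face :: "nat \<Rightarrow> nat \<Rightarrow> bool \<Rightarrow> cmap" where
  "face n i a = (\<lambda>x. if x \<in> verts (n - 1) then take (i - 1) x @ [a] @ drop (i - 1) x else [])"

definition pt :: "vert \<Rightarrow> cmap" where
  "pt u = (\<lambda>x. if x = [] then u else [])"

inductive box_hom :: "nat \<Rightarrow> nat \<Rightarrow> cmap \<Rightarrow> bool" where
  box_id: "box_hom n n (idm n)"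
| box_step: "box_hom m k f \<Longrightarrow> 1 \<le> i \<Longrightarrow> i \<le> Suc k \<Longrightarrow>
     box_hom m (Suc k) (cmp m (face (Suc k) i a) f)"

definition hat_hom :: "nat \<Rightarrow> nat \<Rightarrow> cmap \<Rightarrow> bool" where
  "hat_hom m n f \<longleftrightarrow> is_map m n f
     \<and> (\<forall>x\<in>verts m. \<forall>y\<in>verts m. leq x y \<and> x \<noteq> y \<longrightarrow> leq (f x) (f y) \<and> f x \<noteq> f y)
     \<and> (\<forall>x\<in>verts m. \<forall>y\<in>verts m. hamming x y = 1 \<longrightarrow> hamming (f x) (f y) = 1)"

text \<open>cells n = set of n-cubes; act m n f x = X(f)(x) for f : [m] -> [n], x an n-cube;
  lab n x = label (image in the base object) of the n-cube x.\<close>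
record ('a, 'b) lpsh =
  cells :: "nat \<Rightarrow> 'a set"
  act :: "nat \<Rightarrow> nat \<Rightarrow> cmap \<Rightarrow> 'a \<Rightarrow> 'a"
  lab :: "nat \<Rightarrow> 'a \<Rightarrow> 'b"

definition free_coords :: "nat \<Rightarrow> nat \<Rightarrow> cmap \<Rightarrow> nat set" where
  "free_coords m n f = {j. j < n \<and> (\<exists>x\<in>verts m. \<exists>y\<in>verts m. f x ! j \<noteq> f y ! j)}"

text \<open>!Sigma (with Sigma = UNIV :: 'l set): n-cubes are words of length n, a box map
  deletes the letters at the coordinates where it is constant\<close>
definition bang :: "('l list, unit) lpsh" where
  "bang = \<lparr>cells = (\<lambda>n. {w. length w = n}),
           act = (\<lambda>m n f w. nths w (free_coords m n f)),
           lab = (\<lambda>_ _. ())\<rparr>"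

definition lcube :: "'l list \<Rightarrow> (cmap, 'l list) lpsh" where
  "lcube as = \<lparr>cells = (\<lambda>k. {f. box_hom k (length as) f}),
               act = (\<lambda>m k g f. cmp m f g),
               lab = (\<lambda>k f. nths as (free_coords k (length as) f))\<rparr>"

section \<open>The left adjoint L (pointwise left Kan extension along box -> hat-box)\<close>

definition Lrep :: "('a, 'b) lpsh \<Rightarrow> nat \<Rightarrow> (nat \<times> 'a \<times> cmap) set" where
  "Lrep X n = {(p, x, g). x \<in> cells X p \<and> hat_hom n p g}"

definition Lgen :: "('a, 'b) lpsh \<Rightarrow> nat \<Rightarrow> (nat \<times> 'a \<times> cmap) \<Rightarrow> (nat \<times> 'a \<times> cmap) \<Rightarrow> bool" where
  "Lgen X n r r' \<longleftrightarrow> (\<exists>p p' d x g. box_hom p' p d \<and> x \<in> cells X p \<and> hat_hom n p' g \<and>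
      r = (p', act X p' p d x, g) \<and> r' = (p, x, cmp n d g))"

definition Lrel :: "('a, 'b) lpsh \<Rightarrow> nat \<Rightarrow> (nat \<times> 'a \<times> cmap) \<Rightarrow> (nat \<times> 'a \<times> cmap) \<Rightarrow> bool" where
  "Lrel X n = (sup (Lgen X n) (Lgen X n)\<inverse>\<inverse>)\<^sup>*\<^sup>*"

definition Lcls :: "('a, 'b) lpsh \<Rightarrow> nat \<Rightarrow> (nat \<times> 'a \<times> cmap) \<Rightarrow> (nat \<times> 'a \<times> cmap) set" where
  "Lcls X n r = {r'. Lrel X n r r'}"

definition Lact :: "('a, 'b) lpsh \<Rightarrow> nat \<Rightarrow> nat \<Rightarrow> cmap \<Rightarrow> (nat \<times> 'a \<times> cmap) set \<Rightarrow> (nat \<times> 'a \<times> cmap) set" where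
  "Lact X m n h C = {r'. \<exists>(p, x, g)\<in>C. Lrel X m (p, x, cmp m g h) r'}"

definition Lpsh :: "('a, 'b) lpsh \<Rightarrow> ((nat \<times> 'a \<times> cmap) set, unit) lpsh" where
  "Lpsh X = \<lparr>cells = (\<lambda>n. Lcls X n ` Lrep X n), act = Lact X, lab = (\<lambda>_ _. ())\<rparr>"

text \<open>least congruence whose quotient has the property that two p-cubes (p >= 2)
  with the same boundary are equal\<close>
inductive shrel :: "('a, 'b) lpsh \<Rightarrow> nat \<Rightarrow> 'a \<Rightarrow> 'a \<Rightarrow> bool" for Y where
  sh_refl: "x \<in> cells Y n \<Longrightarrow> shrel Y n x x"
| sh_sym: "shrel Y n x y \<Longrightarrow> shrel Y n y x"
| sh_trans: "shrel Y n x y \<Longrightarrow> shrel Y n y z \<Longrightarrow> shrel Y n x z"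
| sh_cong: "shrel Y n x y \<Longrightarrow> hat_hom m n h \<Longrightarrow> shrel Y m (act Y m n h x) (act Y m n h y)"
| sh_sep: "2 \<le> n \<Longrightarrow> x \<in> cells Y n \<Longrightarrow> y \<in> cells Y n \<Longrightarrow>
     (\<forall>i a. 1 \<le> i \<and> i \<le> n \<longrightarrow>
        shrel Y (n - 1) (act Y (n - 1) n (face n i a) x) (act Y (n - 1) n (face n i a) y)) \<Longrightarrow>
     shrel Y n x y"

definition shcls :: "('a, 'b) lpsh \<Rightarrow> nat \<Rightarrow> 'a \<Rightarrow> 'a set" where
  "shcls Y n x = {y. shrel Y n x y}"

definition sh :: "('a, 'b) lpsh \<Rightarrow> ('a set, unit) lpsh" where
  "sh Y = \<lparr>cells = (\<lambda>n. shcls Y n ` cells Y n),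
           act = (\<lambda>m n h C. {y. \<exists>x\<in>C. shrel Y m (act Y m n h x) y}),
           lab = (\<lambda>_ _. ())\<rparr>"

type_synonym 'l lrep = "nat \<times> 'l list \<times> cmap"
type_synonym 'l shcell = "'l lrep set set"

definition shLbang :: "('l shcell, unit) lpsh" where
  "shLbang = sh (Lpsh bang)"

definition sig1 :: "'l \<Rightarrow> 'l shcell" where
  "sig1 a = shcls (Lpsh (bang :: ('l list, unit) lpsh)) 1 (Lcls bang 1 (1, [a], idm 1))"

text \<open>L of a labelled precubical set: labels go via L(!Sigma) -> sh L(!Sigma)\<close>
definition Llpsh :: "('a, 'l list) lpsh \<Rightarrow> ((nat \<times> 'a \<times> cmap) set, 'l shcell) lpsh" where
  "Llpsh X = \<lparr>cells = (\<lambda>n. Lcls X n ` Lrep X n), act = Lact X,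
              lab = (\<lambda>n C. SOME c. \<exists>(p, x, g)\<in>C.
                        c = shcls (Lpsh bang) n (Lcls bang n (p, lab X p x, g)))\<rparr>"

record ('v, 'e, 'l) oned =
  oV :: "'v set"
  oE :: "'e set"
  src :: "'e \<Rightarrow> 'v"
  tgt :: "'e \<Rightarrow> 'v"
  ell :: "'e \<Rightarrow> 'l"

definition trunc_box :: "('a, 'l list) lpsh \<Rightarrow> ('a, 'a, 'l) oned" where
  "trunc_box X = \<lparr>oV = cells X 0, oE = cells X 1,
     src = act X 0 1 (face 1 1 False), tgt = act X 0 1 (face 1 1 True),
     ell = (\<lambda>e. hd (lab X 1 e))\<rparr>"

definition trunc_hat :: "('a, 'l shcell) lpsh \<Rightarrow> ('a, 'a, 'l) oned" where
  "trunc_hat X = \<lparr>oV = cells X 0, oE = cells X 1,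
     src = act X 0 1 (face 1 1 False), tgt = act X 0 1 (face 1 1 True),
     ell = (\<lambda>e. THE a. sig1 a = lab X 1 e)\<rparr>"

datatype ('v1, 'e1, 'v2, 'e2) pedge = EL 'e1 'v2 | ER 'v1 'e2 | ES 'e1 'e2

definition fprod :: "('l \<Rightarrow> 'l) \<Rightarrow> 'l \<Rightarrow> ('v1, 'e1, 'l) oned \<Rightarrow> ('v2, 'e2, 'l) oned
    \<Rightarrow> ('v1 \<times> 'v2, ('v1, 'e1, 'v2, 'e2) pedge, 'l) oned" where
  "fprod bar \<tau> K L = \<lparr>oV = oV K \<times> oV L,
     oE = {EL x y | x y. x \<in> oE K \<and> y \<in> oV L} \<union> {ER x y | x y. x \<in> oV K \<and> y \<in> oE L}
          \<union> {ES x y | x y. x \<in> oE K \<and> y \<in> oE L \<and> ell K x \<noteq> \<tau> \<and> bar (ell K x) = ell L y},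
     src = (\<lambda>e. case e of EL x y \<Rightarrow> (src K x, y) | ER x y \<Rightarrow> (x, src L y) | ES x y \<Rightarrow> (src K x, src L y)),
     tgt = (\<lambda>e. case e of EL x y \<Rightarrow> (tgt K x, y) | ER x y \<Rightarrow> (x, tgt L y) | ES x y \<Rightarrow> (tgt K x, tgt L y)),
     ell = (\<lambda>e. case e of EL x y \<Rightarrow> ell K x | ER x y \<Rightarrow> ell L y | ES x y \<Rightarrow> \<tau>)\<rparr>"

text \<open>n-cubes of cosk_1^{box,Sigma}(K): an n-cube w of !Sigma together with a morphism
  of 1-dimensional labelled sets box[n]_{<=1} -> K over !Sigma (vertex part, edge part)\<close>
definition box_cosk_cells :: "('v, 'e, 'l) oned \<Rightarrow> nat \<Rightarrow> ('l list \<times> (cmap \<Rightarrow> 'v) \<times> (cmap \<Rightarrow> 'e)) set" where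
  "box_cosk_cells K n = {(w, f0, f1). length w = n \<and>
     (\<forall>v. box_hom 0 n v \<longrightarrow> f0 v \<in> oV K) \<and>
     (\<forall>e. box_hom 1 n e \<longrightarrow> f1 e \<in> oE K
          \<and> src K (f1 e) = f0 (cmp 0 e (face 1 1 False))
          \<and> tgt K (f1 e) = f0 (cmp 0 e (face 1 1 True))
          \<and> [ell K (f1 e)] = nths w (free_coords 1 n e)) \<and>
     (\<forall>v. \<not> box_hom 0 n v \<longrightarrow> f0 v = undefined) \<and>
     (\<forall>e. \<not> box_hom 1 n e \<longrightarrow> f1 e = undefined)}"

definition box_cosk_act :: "nat \<Rightarrow> nat \<Rightarrow> cmap \<Rightarrow> ('l list \<times> (cmap \<Rightarrow> 'v) \<times> (cmap \<Rightarrow> 'e))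
    \<Rightarrow> ('l list \<times> (cmap \<Rightarrow> 'v) \<times> (cmap \<Rightarrow> 'e))" where
  "box_cosk_act m n f c = (case c of (w, f0, f1) \<Rightarrow>
     (nths w (free_coords m n f),
      (\<lambda>v. if box_hom 0 m v then f0 (cmp 0 f v) else undefined),
      (\<lambda>e. if box_hom 1 m e then f1 (cmp 1 f e) else undefined)))"

definition box_cosk :: "('v, 'e, 'l) oned \<Rightarrow> ('l list \<times> (cmap \<Rightarrow> 'v) \<times> (cmap \<Rightarrow> 'e), 'l list) lpsh" where
  "box_cosk K = \<lparr>cells = box_cosk_cells K, act = box_cosk_act, lab = (\<lambda>n c. fst c)\<rparr>"

definition first_occ :: "nat list \<Rightarrow> nat \<Rightarrow> nat" where
  "first_occ is i = (LEAST k. k < length is \<and> is ! k = i)"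

text \<open>h : [n'] -> [p] is non-twisted (coordinates 0-indexed)\<close>
definition nontwisted :: "nat \<Rightarrow> nat \<Rightarrow> (vert \<Rightarrow> vert) \<Rightarrow> bool" where
  "nontwisted n' p h \<longleftrightarrow> (\<exists>q \<psi> is. box_hom q p \<psi> \<and> length is = q \<and> set is = {0..<n'} \<and>
     (\<forall>i j. i < j \<and> j < n' \<longrightarrow> first_occ is i < first_occ is j) \<and>
     (\<forall>u\<in>verts n'. h u = \<psi> (map (\<lambda>i. u ! i) is)))"

text \<open>COSK^Sigma(K), where ident identifies the vertex set of K with [p]\<close>
definition COSK :: "('v \<Rightarrow> vert) \<Rightarrow> nat \<Rightarrow> ('v, 'e, 'l) oned
    \<Rightarrow> ('l list \<times> (cmap \<Rightarrow> 'v) \<times> (cmap \<Rightarrow> 'e), 'l list) lpsh" where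
  "COSK ident p K = \<lparr>cells = (\<lambda>n. {c \<in> box_cosk_cells K n.
        n \<le> 1 \<or> nontwisted n p (\<lambda>u. ident (fst (snd c) (pt u)))}),
     act = box_cosk_act, lab = (\<lambda>n c. fst c)\<rparr>"

text \<open>vertices of box[m]_{<=1} x box[n]_{<=1} identified with [m] x [n] = [m+n]\<close>
definition vid :: "cmap \<times> cmap \<Rightarrow> vert" where
  "vid v = fst v [] @ snd v []"

text \<open>n-cubes of cosk_1^{hat,Sigma}(K): an n-cube c of sh L(!Sigma) with a morphism
  hat-box[n]_{<=1} -> K over the base\<close>
definition hat_cosk_cells :: "('v, 'e, 'l) oned \<Rightarrow> nat \<Rightarrow> ('l shcell \<times> (cmap \<Rightarrow> 'v) \<times> (cmap \<Rightarrow> 'e)) set" where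
  "hat_cosk_cells K n = {(c, f0, f1). c \<in> cells shLbang n \<and>
     (\<forall>v. hat_hom 0 n v \<longrightarrow> f0 v \<in> oV K) \<and>
     (\<forall>e. hat_hom 1 n e \<longrightarrow> f1 e \<in> oE K
          \<and> src K (f1 e) = f0 (cmp 0 e (face 1 1 False))
          \<and> tgt K (f1 e) = f0 (cmp 0 e (face 1 1 True))
          \<and> act shLbang 1 n e c = sig1 (ell K (f1 e))) \<and>
     (\<forall>v. \<not> hat_hom 0 n v \<longrightarrow> f0 v = undefined) \<and>
     (\<forall>e. \<not> hat_hom 1 n e \<longrightarrow> f1 e = undefined)}"

definition hat_cosk :: "('v, 'e, 'l) oned \<Rightarrow> ('l shcell \<times> (cmap \<Rightarrow> 'v) \<times> (cmap \<Rightarrow> 'e), 'l shcell) lpsh" where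
  "hat_cosk K = \<lparr>cells = hat_cosk_cells K,
     act = (\<lambda>m n h c. case c of (d, f0, f1) \<Rightarrow>
        (act shLbang m n h d,
         (\<lambda>v. if hat_hom 0 m v then f0 (cmp 0 h v) else undefined),
         (\<lambda>e. if hat_hom 1 m e then f1 (cmp 1 h e) else undefined))),
     lab = (\<lambda>n c. fst c)\<rparr>"

definition lmor :: "('a, 'c) lpsh \<Rightarrow> ('b, 'c) lpsh \<Rightarrow> (nat \<Rightarrow> 'a \<Rightarrow> 'b) \<Rightarrow> bool" where
  "lmor X Y \<phi> \<longleftrightarrow>
     (\<forall>n x. x \<in> cells X n \<longrightarrow> \<phi> n x \<in> cells Y n \<and> lab Y n (\<phi> n x) = lab X n x) \<and>
     (\<forall>m n h x. hat_hom m n h \<and> x \<in> cells X n \<longrightarrow> \<phi> m (act X m n h x) = act Y m n h (\<phi> n x))"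

definition lmono :: "('a, 'c) lpsh \<Rightarrow> ('b, 'c) lpsh \<Rightarrow> (nat \<Rightarrow> 'a \<Rightarrow> 'b) \<Rightarrow> bool" where
  "lmono X Y \<phi> \<longleftrightarrow> lmor X Y \<phi> \<and> (\<forall>n. inj_on (\<phi> n) (cells X n))"

definition liso :: "('a, 'c) lpsh \<Rightarrow> ('b, 'c) lpsh \<Rightarrow> (nat \<Rightarrow> 'a \<Rightarrow> 'b) \<Rightarrow> bool" where
  "liso X Y \<phi> \<longleftrightarrow> lmor X Y \<phi> \<and> (\<forall>n. bij_betw (\<phi> n) (cells X n) (cells Y n))"

definition lhs8p5 :: "('l \<Rightarrow> 'l) \<Rightarrow> 'l \<Rightarrow> 'l list \<Rightarrow> 'l list \<Rightarrow> _" where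
  "lhs8p5 bar \<tau> as bs = Llpsh (COSK vid (length as + length bs)
      (fprod bar \<tau> (trunc_box (lcube as)) (trunc_box (lcube bs))))"

definition rhs8p5 :: "('l \<Rightarrow> 'l) \<Rightarrow> 'l \<Rightarrow> 'l list \<Rightarrow> 'l list \<Rightarrow> _" where
  "rhs8p5 bar \<tau> as bs = hat_cosk (fprod bar \<tau> (trunc_hat (Llpsh (lcube as))) (trunc_hat (Llpsh (lcube bs))))"

end

theory Submission
  imports Defs
begin

text \<open>
  A box map is a list of slots, each a constant or a coordinate, with every coordinate occurring
  exactly once and in order. An adjacency-preserving map \<open>g\<close> sends \<open>[n]\<close> into the interval between
  \<open>g 0\<close> and \<open>g 1\<close>, which is an \<open>n\<close>-cube; so \<open>g\<close> is a box map after an adjacency-preserving endomap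
  of \<open>[n]\<close>, and every \<open>n\<close>-cube of \<open>L(X)\<close> is represented by an \<open>n\<close>-cube of \<open>X\<close> together with such
  an endomap. A non-twisted map is again a list of slots, now with possible repetitions, but with the
  first occurrences in order. As the coordinate functions of an endomap are non-constant and pairwise
  distinct, both the list and the endomap can be read off their composite. This gives injectivity,
  because edges of the fibered product are determined by their end points.

  For strictness take the labels \<open>a, a\<close> and \<open>bar a, bar a\<close>: the square
  \<open>u \<mapsto> (u, max u, min u)\<close> of synchronised edges is not in the image, and since only finitely many
  squares carry its label, no isomorphism of any kind can exist.
\<close>

subsection \<open>Box maps as lists of slots\<close>

lemma verts_iff [simp]: "v \<in> verts n \<longleftrightarrow> length v = n"
  by (simp add: verts_def)

datatype slot = Cst bool | Crd nat

primrec ev :: "bool list \<Rightarrow> slot \<Rightarrow> bool" where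
  "ev u (Cst b) = b"
| "ev u (Crd i) = u ! i"

fun coords :: "slot list \<Rightarrow> nat list" where
  "coords [] = []"
| "coords (Cst b # P) = coords P"
| "coords (Crd i # P) = i # coords P"

text \<open>The value \<open>[]\<close> outside \<open>verts m\<close> is the normalisation of
  \<open>is_map\<close>, so equal maps are equal as functions.\<close>

definition slot_map :: "nat \<Rightarrow> slot list \<Rightarrow> cmap" where
  "slot_map m P = (\<lambda>u. if u \<in> verts m then map (ev u) P else [])"

lemma coords_append [simp]: "coords (P @ Q) = coords P @ coords Q"
  by (induction P rule: coords.induct) auto

lemma set_coords: "i \<in> set (coords P) \<longleftrightarrow> Crd i \<in> set P"
  by (induction P rule: coords.induct) auto

lemma coords_map_Crd [simp]: "coords (map Crd is) = is"
  by (induction "is") auto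

lemma coords_no_Cst: "(\<And>b. Cst b \<notin> set P) \<Longrightarrow> P = map Crd (coords P)"
  by (induction P rule: coords.induct) auto

text \<open>A face map inserts a constant slot and leaves the listed coordinates alone; the identity
  is the list of all coordinates.\<close>

lemma box_hom_pattern:
  assumes "box_hom m n f"
  obtains P where "length P = n" "coords P = [0..<m]" "f = slot_map m P"
proof -
  from assms have "\<exists>P. length P = n \<and> coords P = [0..<m] \<and> f = slot_map m P"
  proof induction
    case (box_id n)
    have "idm n = slot_map n (map Crd [0..<n])"
      by (auto simp: idm_def slot_map_def fun_eq_iff intro: nth_equalityI)
    then show ?case
      by (intro exI[of _ "map Crd [0..<n]"]) auto
  next
    case (box_step m k f i a)
    then obtain P where P: "length P = k" "coords P = [0..<m]" "f = slot_map m P" by blast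
    let ?Q = "take (i - 1) P @ [Cst a] @ drop (i - 1) P"
    have "coords ?Q = coords (take (i - 1) P @ drop (i - 1) P)"
      unfolding coords_append by simp
    then have "coords ?Q = [0..<m]" using P by simp
    moreover have "length ?Q = Suc k" using P box_step by simp
    moreover have "cmp m (face (Suc k) i a) f = slot_map m ?Q"
      using P by (auto simp: cmp_def face_def slot_map_def fun_eq_iff take_map drop_map)
    ultimately show ?case by blast
  qed
  then show ?thesis using that by blast
qed

text \<open>Each constant slot can be removed by splitting off a face map, until only the identity
  remains.\<close>

lemma box_hom_slot_map:
  "coords P = [0..<m] \<Longrightarrow> box_hom m (length P) (slot_map m P)"
proof (induction "length P" arbitrary: P rule: less_induct)
  case less
  show ?case
  proof (cases "\<exists>b. Cst b \<in> set P")
    case False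
    then have "P = map Crd [0..<m]" using coords_no_Cst[of P] less.prems by auto
    moreover have "idm m = slot_map m (map Crd [0..<m])"
      by (auto simp: idm_def slot_map_def fun_eq_iff intro: nth_equalityI)
    ultimately show ?thesis using box_id[of m] by simp
  next
    case True
    then obtain b Q R where P: "P = Q @ Cst b # R" by (meson split_list)
    have "box_hom m (length (Q @ R)) (slot_map m (Q @ R))"
      using less.prems by (intro less.hyps) (auto simp: P)
    \<comment> \<open>Face positions count from 1, so the constant behind \<open>Q\<close> has
      position \<open>Suc (length Q)\<close>.\<close>
    then have "box_hom m (Suc (length (Q @ R)))
        (cmp m (face (Suc (length (Q @ R))) (Suc (length Q)) b) (slot_map m (Q @ R)))"
      by (rule box_step) auto
    moreover have "cmp m (face (Suc (length (Q @ R))) (Suc (length Q)) b) (slot_map m (Q @ R)) = slot_map m P"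
      by (auto simp: P cmp_def face_def slot_map_def fun_eq_iff)
    ultimately show ?thesis by (simp add: P)
  qed
qed

lemma length_coords: "length (coords P) = card {i. i < length P \<and> (\<exists>k. P ! i = Crd k)}"
proof (induction P rule: rev_induct)
  case (snoc s P)
  have "{i. i < length (P @ [s]) \<and> (\<exists>k. (P @ [s]) ! i = Crd k)} =
     {i. i < length P \<and> (\<exists>k. P ! i = Crd k)} \<union> (if \<exists>k. s = Crd k then {length P} else {})"
    by (auto simp: nth_append less_Suc_eq)
  then show ?case using snoc by (cases s) auto
qed simp

text \<open>The listed coordinates are 0, 1, and so on, so an index equals the number of coordinate
  slots before it.\<close>

lemma coord_eq_rank:
  assumes "coords P = [0..<m]" "i < length P" "P ! i = Crd k"
  shows "k = card {j. j < i \<and> (\<exists>k. P ! j = Crd k)}"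
proof -
  have "P = take i P @ Crd k # drop (Suc i) P"
    using assms id_take_nth_drop by metis
  then have "coords P = coords (take i P) @ k # coords (drop (Suc i) P)"
    by (metis coords.simps(3) coords_append)
  then have "coords P ! length (coords (take i P)) = k"
     "length (coords (take i P)) < length (coords P)" by auto
  then have "k = length (coords (take i P))" using assms by simp
  also have "\<dots> = card {j. j < i \<and> (\<exists>k. P ! j = Crd k)}"
    unfolding length_coords using assms by (intro arg_cong[of _ _ card]) auto
  finally show ?thesis .
qed

lemma coord_less:
  assumes "coords P = [0..<m]" "i < length P" "P ! i = Crd k"
  shows "k < m"
  using assms set_coords[of k P] by (metis atLeastLessThan_iff nth_mem set_upt)

lemma coord_position_unique:
  assumes "coords P = [0..<m]" "i < length P" "P ! i = Crd k" "j < length P" "P ! j = Crd k"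
  shows "i = j"
proof -
  have False if ij: "i < j" and "j < length P" "P ! i = Crd k" "P ! j = Crd k" for i j
  proof -
    have "card {l. l < i \<and> (\<exists>k. P ! l = Crd k)} < card {l. l < j \<and> (\<exists>k. P ! l = Crd k)}"
      using that by (intro psubset_card_mono) auto
    then show False
      using coord_eq_rank[OF assms(1), of i k] coord_eq_rank[OF assms(1), of j k] that by simp
  qed
  then show ?thesis using assms by (meson linorder_neqE_nat)
qed

lemma coord_position_exists:
  assumes "coords P = [0..<m]" "k < m"
  obtains i where "i < length P" "P ! i = Crd k"
  using assms set_coords[of k P] by (auto simp: in_set_conv_nth)

section \<open>Composition of box maps by substitution\<close>

primrec slot_subst :: "slot list \<Rightarrow> slot \<Rightarrow> slot" where
  "slot_subst Q (Cst b) = Cst b"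
| "slot_subst Q (Crd i) = Q ! i"

lemma coords_subst:
  "coords (map (slot_subst Q) P) = concat (map (\<lambda>i. coords [Q ! i]) (coords P))"
proof (induction P rule: coords.induct)
  case (3 i P)
  then show ?case by (cases "Q ! i") auto
qed auto

lemma coords_conv_concat: "coords P = concat (map (\<lambda>i. coords [P ! i]) [0..<length P])"
proof (induction P rule: rev_induct)
  case (snoc s P)
  have "map (\<lambda>i. coords [(P @ [s]) ! i]) [0..<length P] = map (\<lambda>i. coords [P ! i]) [0..<length P]"
    by (auto simp: nth_append)
  then show ?case using snoc[symmetric] by (simp del: map_eq_conv)
qed simp

text \<open>\<open>P\<close> uses every slot of \<open>Q\<close> once and in order, so substitution
  only interleaves constants into \<open>Q\<close>.\<close>

lemma coords_subst_box:
  assumes "coords P = [0..<length Q]"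
  shows "coords (map (slot_subst Q) P) = coords Q"
  unfolding coords_subst assms coords_conv_concat[of Q, symmetric] ..

lemma ev_subst: "(\<And>i. s = Crd i \<Longrightarrow> i < length Q) \<Longrightarrow> ev (map (ev u) Q) s = ev u (slot_subst Q s)"
  by (cases s) auto

lemma cmp_slot_map:
  assumes "\<And>i. Crd i \<in> set P \<Longrightarrow> i < length Q"
  shows "cmp m (slot_map (length Q) P) (slot_map m Q) = slot_map m (map (slot_subst Q) P)"
  using assms by (auto simp: cmp_def slot_map_def fun_eq_iff intro!: ev_subst)

lemma box_hom_cmp:
  assumes "box_hom k m g" "box_hom m n f"
  shows "box_hom k n (cmp k f g)"
proof -
  obtain Q where Q: "length Q = m" "coords Q = [0..<k]" "g = slot_map k Q"
    using assms(1) by (rule box_hom_pattern)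
  obtain P where P: "length P = n" "coords P = [0..<m]" "f = slot_map m P"
    using assms(2) by (rule box_hom_pattern)
  have "i < length Q" if "Crd i \<in> set P" for i
    using that P Q set_coords[of i P] by simp
  then have "cmp k f g = slot_map k (map (slot_subst Q) P)"
    using cmp_slot_map[of P Q k] P Q by simp
  then show ?thesis
    using box_hom_slot_map[of "map (slot_subst Q) P" k] coords_subst_box[of P Q] P Q by simp
qed

section \<open>Free coordinates and the action of box maps on words\<close>

lemma free_coords_slot_map:
  assumes "coords P = [0..<m]"
  shows "free_coords m (length P) (slot_map m P) = {i. i < length P \<and> (\<exists>k. P ! i = Crd k)}"
proof -
  \<comment> \<open>The bottom and top vertices differ in every coordinate, so this one pair
    witnesses all free positions.\<close>
  have "\<exists>x\<in>verts m. \<exists>y\<in>verts m. slot_map m P x ! i \<noteq> slot_map m P y ! i"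
    if "i < length P" "P ! i = Crd k" for i k
    using that coord_less[OF assms that]
    by (intro bexI[of _ "replicate m False"] bexI[of _ "replicate m True"]) (auto simp: slot_map_def)
  moreover have "\<exists>k. P ! i = Crd k" if "i < length P" "length x = m" "length y = m"
      "slot_map m P x ! i \<noteq> slot_map m P y ! i" for i x y
    using that by (cases "P ! i") (auto simp: slot_map_def)
  ultimately show ?thesis by (auto simp: free_coords_def)
qed

lemma length_nths_free_coords:
  assumes "box_hom m n f" "length w = n"
  shows "length (nths w (free_coords m n f)) = m"
proof -
  obtain P where P: "length P = n" "coords P = [0..<m]" "f = slot_map m P"
    using assms(1) by (rule box_hom_pattern)
  have "{i. i < n \<and> i \<in> free_coords m n f} = {i. i < length P \<and> (\<exists>k. P ! i = Crd k)}"
    using free_coords_slot_map[OF P(2)] P by auto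
  then show ?thesis
    using length_coords[of P] P by (simp add: length_nths assms)
qed

text \<open>This is functoriality of \<open>bang\<close>. By \<open>nths_nths\<close> it becomes a
  statement about ranks of free positions, which \<open>coord_eq_rank\<close> supplies.\<close>

lemma nths_free_coords_cmp:
  assumes "box_hom k m g" "box_hom m n f"
  shows "nths (nths w (free_coords m n f)) (free_coords k m g) = nths w (free_coords k n (cmp k f g))"
proof -
  obtain Q where Q: "length Q = m" "coords Q = [0..<k]" "g = slot_map k Q"
    using assms(1) by (rule box_hom_pattern)
  obtain P where P: "length P = n" "coords P = [0..<m]" "f = slot_map m P"
    using assms(2) by (rule box_hom_pattern)
  have lt: "i < length Q" if "Crd i \<in> set P" for i
    using that P Q set_coords[of i P] by simp
  let ?PQ = "map (slot_subst Q) P"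
  have c: "cmp k f g = slot_map k ?PQ"
    using cmp_slot_map[of P Q k] lt P Q by simp
  have A: "free_coords m n f = {i. i < n \<and> (\<exists>k. P ! i = Crd k)}" (is "_ = ?A")
    using free_coords_slot_map[OF P(2)] P by simp
  have B: "free_coords k m g = {i. i < m \<and> (\<exists>k. Q ! i = Crd k)}" (is "_ = ?B")
    using free_coords_slot_map[OF Q(2)] Q by simp
  have C: "free_coords k n (cmp k f g) = {i. i < n \<and> (\<exists>k. ?PQ ! i = Crd k)}" (is "_ = ?C")
    using free_coords_slot_map[of ?PQ k] coords_subst_box[of P Q] P Q c by simp
  have "{i \<in> ?A. card {i' \<in> ?A. i' < i} \<in> ?B} = ?C"
  proof (intro set_eqI)
    fix i
    show "i \<in> {i \<in> ?A. card {i' \<in> ?A. i' < i} \<in> ?B} \<longleftrightarrow> i \<in> ?C"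
    proof (cases "i < n")
      case True
      then have s: "{i' \<in> ?A. i' < i} = {j. j < i \<and> (\<exists>k. P ! j = Crd k)}" by auto
      show ?thesis
      proof (cases "P ! i")
        case (Crd l)
        then have "l = card {i' \<in> ?A. i' < i}" "l < m"
          using coord_eq_rank[OF P(2), of i l] coord_less[OF P(2), of i l] True P s by auto
        then show ?thesis using Crd True P by auto
      qed (use True P in auto)
    qed auto
  qed
  then show ?thesis unfolding A B C nths_nths by simp
qed

subsection \<open>Adjacency-preserving maps\<close>

text \<open>This is the rank function of the Boolean lattice.\<close>

definition weight :: "vert \<Rightarrow> nat" where
  "weight x = card {i. i < length x \<and> x ! i}"

lemma weight_le: "weight x \<le> length x"
proof -
  have "card {i. i < length x \<and> x ! i} \<le> card {..<length x}" by (intro card_mono) auto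
  then show ?thesis by (simp add: weight_def)
qed

lemma weight_replicate [simp]: "weight (replicate n b) = (if b then n else 0)"
proof -
  have "{i. i < n \<and> replicate n b ! i} = (if b then {..<n} else {})" by auto
  then show ?thesis by (simp add: weight_def)
qed

lemma weight_eq_0: "weight x = 0 \<Longrightarrow> x = replicate (length x) False"
  by (intro nth_equalityI) (auto simp: weight_def)

lemma weight_eq_length: "weight x = length x \<Longrightarrow> x = replicate (length x) True"
proof -
  assume "weight x = length x"
  then have "card {i. i < length x \<and> x ! i} = card {..<length x}" by (simp add: weight_def)
  moreover have "{i. i < length x \<and> x ! i} \<subseteq> {..<length x}" by auto
  ultimately have "{i. i < length x \<and> x ! i} = {..<length x}"
    by (simp add: card_subset_eq)
  then have "\<forall>i<length x. x ! i" by auto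
  then show ?thesis by (intro nth_equalityI) auto
qed

lemma weight_update: "i < length x \<Longrightarrow> \<not> x ! i \<Longrightarrow> weight (x[i := True]) = Suc (weight x)"
proof -
  assume a: "i < length x" "\<not> x ! i"
  then have "{j. j < length x \<and> x[i := True] ! j} = insert i {j. j < length x \<and> x ! j}"
    by (auto simp: nth_list_update)
  then show ?thesis using a by (simp add: weight_def)
qed

text \<open>Every vertex is reached from the bottom by raising one coordinate at a time, so
  properties can be carried along edges.\<close>

lemma verts_induct [consumes 1, case_names zero step]:
  assumes "length x = n"
    and "P (replicate n False)"
    and "\<And>y i. length y = n \<Longrightarrow> i < n \<Longrightarrow> \<not> y ! i \<Longrightarrow> P y \<Longrightarrow> P (y[i := True])"
  shows "P x"
  using assms(1)
proof (induction "weight x" arbitrary: x)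
  case 0
  then show ?case using assms(2) weight_eq_0[of x] by simp
next
  case (Suc k)
  then obtain i where i: "i < length x" "x ! i"
    by (metis (mono_tags, lifting) card.empty empty_Collect_eq nat.distinct(1) weight_def)
  let ?y = "x[i := False]"
  have x: "?y[i := True] = x" using i by (metis list_update_id list_update_overwrite)
  have "weight (?y[i := True]) = Suc (weight ?y)"
    using i by (intro weight_update) auto
  then have "P ?y" using Suc x by simp
  then have "P (?y[i := True])" using Suc.prems i by (intro assms(3)) auto
  then show ?case by (simp only: x)
qed

lemma leq_refl [simp]: "leq x x"
  by (simp add: leq_def)

lemma leq_update: "leq x (x[i := True])"
  by (cases "i < length x") (auto simp: leq_def nth_list_update)

lemma hamming_update:
  assumes "i < length x" "\<not> x ! i" shows "hamming x (x[i := True]) = 1"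
proof -
  have "{j. j < length x \<and> x ! j \<noteq> x[i := True] ! j} = {i}"
    using assms by (auto simp: nth_list_update)
  then show ?thesis by (simp add: hamming_def)
qed

lemma leq_hamming_1:
  assumes "leq x y" "hamming x y = 1"
  obtains i where "i < length x" "\<not> x ! i" "y = x[i := True]"
proof -
  obtain i where i: "{i. i < length x \<and> x ! i \<noteq> y ! i} = {i}"
    using assms(2) by (auto simp: hamming_def card_1_singleton_iff)
  then have *: "j < length x \<Longrightarrow> x ! j \<noteq> y ! j \<longleftrightarrow> j = i" for j by auto
  have "i < length x" using i by auto
  moreover have "\<not> x ! i" "y ! i" using *[of i] \<open>i < length x\<close> assms(1) by (auto simp: leq_def)
  moreover have "y = x[i := True]"
  proof (rule nth_equalityI)
    show "length y = length (x[i := True])" using assms(1) by (simp add: leq_def)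
    show "y ! j = x[i := True] ! j" if "j < length y" for j
      using that assms(1) *[of j] \<open>y ! i\<close> \<open>i < length x\<close> by (cases "j = i") (auto simp: leq_def)
  qed
  ultimately show ?thesis using that by blast
qed

section \<open>Behaviour of adjacency-preserving maps along edges\<close>

lemma hat_hom_length: "hat_hom m n f \<Longrightarrow> length x = m \<Longrightarrow> length (f x) = n"
  by (auto simp: hat_hom_def is_map_def)

lemma hat_hom_outside: "hat_hom m n f \<Longrightarrow> length x \<noteq> m \<Longrightarrow> f x = []"
  by (auto simp: hat_hom_def is_map_def)

lemma hat_hom_eqI:
  assumes "hat_hom m n f" "hat_hom m n g" "\<And>x. length x = m \<Longrightarrow> f x = g x"
  shows "f = g"
proof
  show "f x = g x" for x
    using assms(3) hat_hom_outside[OF assms(1)] hat_hom_outside[OF assms(2)]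
    by (cases "length x = m") simp_all
qed

lemma hat_hom_idm: "hat_hom n n (idm n)"
  by (auto simp: hat_hom_def is_map_def idm_def)

lemma hat_hom_cmp:
  assumes "hat_hom k m g" "hat_hom m n f" shows "hat_hom k n (cmp k f g)"
  using assms by (simp add: hat_hom_def is_map_def cmp_def)

text \<open>Monotonicity fixes the direction of the change and adjacency its size, so exactly one
  coordinate is raised.\<close>

lemma hat_hom_step:
  assumes "hat_hom m n f" "length y = m" "i < m" "\<not> y ! i"
  obtains j where "j < n" "\<not> f y ! j" "f (y[i := True]) = (f y)[j := True]"
proof -
  have "y \<noteq> y[i := True]" using assms by (metis nth_list_update_eq)
  then have "leq (f y) (f (y[i := True]))" "hamming (f y) (f (y[i := True])) = 1"
    using assms leq_update[of y i] hamming_update[of i y] by (simp_all add: hat_hom_def)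
  then show ?thesis
    using that hat_hom_length[OF assms(1,2)] by (metis leq_hamming_1)
qed

text \<open>An upward edge raises the weight by one both before and after applying \<open>f\<close>,
  so the difference is constant.\<close>

lemma hat_hom_weight:
  assumes "hat_hom m n f" "length x = m"
  shows "weight (f x) = weight (f (replicate m False)) + weight x"
  using assms(2)
proof (induction rule: verts_induct)
  case (step y i)
  then show ?case
    using hat_hom_step[OF assms(1) step(1-3)] hat_hom_length[OF assms(1)]
    by (metis add_Suc_right weight_update)
qed simp

lemma hat_hom_mono:
  assumes "hat_hom m n f" "length x = m" "length y = m" "leq x y"
  shows "leq (f x) (f y)"
  using assms by (cases "x = y") (simp_all add: hat_hom_def)

text \<open>The weights of the two images differ by \<open>n\<close>, and weights in
  \<open>[n]\<close> lie between 0 and \<open>n\<close>.\<close>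

lemma hat_endo_bounds:
  assumes "hat_hom n n f"
  shows "f (replicate n False) = replicate n False" "f (replicate n True) = replicate n True"
proof -
  have l: "length (f (replicate n b)) = n" for b using hat_hom_length[OF assms] by simp
  have e: "weight (f (replicate n True)) = weight (f (replicate n False)) + n"
    using hat_hom_weight[OF assms, of "replicate n True"] by simp
  then have "weight (f (replicate n False)) = 0" "weight (f (replicate n True)) = n"
    using weight_le[of "f (replicate n True)"] l by auto
  then show "f (replicate n False) = replicate n False" "f (replicate n True) = replicate n True"
    using weight_eq_0[of "f (replicate n False)"] weight_eq_length[of "f (replicate n True)"] l by auto
qed

text \<open>If two coordinate functions agreed, neither could ever become true, because an upward
  edge changes only one coordinate of the image. The top vertex contradicts this.\<close>

lemma hat_endo_coords_distinct:
  assumes "hat_hom n n f" "i < n" "j < n" "i \<noteq> j"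
  shows "\<exists>x. length x = n \<and> f x ! i \<noteq> f x ! j"
proof (rule ccontr)
  assume "\<not> ?thesis"
  then have eq: "f x ! i = f x ! j" if "length x = n" for x using that by blast
  have "\<not> f x ! i" if "length x = n" for x
    using that
  proof (induction rule: verts_induct)
    case zero
    then show ?case using hat_endo_bounds[OF assms(1)] assms(2) by simp
  next
    case (step y k)
    obtain l where l: "l < n" "\<not> f y ! l" "f (y[k := True]) = (f y)[l := True]"
      using hat_hom_step[OF assms(1) step(1-3)] .
    have len: "length (f y) = n" using hat_hom_length assms(1) step(1) by blast
    have yj: "\<not> f y ! j" using step eq by simp
    have "f (y[k := True]) ! i = f (y[k := True]) ! j" using eq step(1) by simp
    then show ?case using l assms step.IH yj len
      by (metis nth_list_update_neq)
  qed
  then show False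
    using hat_endo_bounds(2)[OF assms(1)] assms(2) by (metis length_replicate nth_replicate)
qed

text \<open>Each input coordinate is copied to exactly one output position, so a change of one
  coordinate stays a change of one.\<close>

lemma box_hat: "box_hom m n f \<Longrightarrow> hat_hom m n f"
proof -
  assume "box_hom m n f"
  then obtain P where P: "length P = n" "coords P = [0..<m]" "f = slot_map m P"
    by (rule box_hom_pattern)
  have f: "f x ! i = ev x (P ! i)" "length (f x) = n" if "length x = m" "i < n" for x i
    using that P by (auto simp: slot_map_def)
  have len: "length (f x) = n" if "length x = m" for x using that P by (simp add: slot_map_def)
  have mono: "leq (f x) (f y)" if "length x = m" "length y = m" "leq x y" for x y
  proof -
    have "f y ! i" if "i < n" "f x ! i" for i
      using that f \<open>length x = m\<close> \<open>length y = m\<close> \<open>leq x y\<close> coord_less[OF P(2), of i] P(1)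
      by (cases "P ! i") (auto simp: leq_def)
    then show ?thesis using len that by (simp add: leq_def)
  qed
  have inj: "f x \<noteq> f y" if "length x = m" "length y = m" "x \<noteq> y" for x y
  proof -
    obtain k where k: "k < m" "x ! k \<noteq> y ! k" using \<open>x \<noteq> y\<close> \<open>length x = m\<close> \<open>length y = m\<close>
      by (auto simp: list_eq_iff_nth_eq)
    obtain i where "i < n" "P ! i = Crd k" using coord_position_exists[OF P(2) k(1)] P(1) by blast
    then show ?thesis using f(1) k(2) \<open>length x = m\<close> \<open>length y = m\<close> by (metis ev.simps(2))
  qed
  have ham: "hamming (f x) (f y) = 1" if "length x = m" "length y = m" "hamming x y = 1" for x y
  proof -
    obtain k where "{i. i < length x \<and> x ! i \<noteq> y ! i} = {k}"
      using \<open>hamming x y = 1\<close> by (auto simp: hamming_def card_1_singleton_iff)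
    then have k: "j < m \<Longrightarrow> x ! j \<noteq> y ! j \<longleftrightarrow> j = k" "k < m" for j using that by auto
    obtain i where i: "i < n" "P ! i = Crd k" using coord_position_exists[OF P(2) k(2)] P(1) by blast
    have "f x ! j \<noteq> f y ! j \<longleftrightarrow> j = i" if "j < n" for j
    proof (cases "P ! j")
      case (Cst b)
      then show ?thesis using f that i \<open>length x = m\<close> \<open>length y = m\<close> by auto
    next
      case (Crd l)
      then have "l < m" using coord_less[OF P(2), of j l] P(1) that by simp
      have "l = k \<longleftrightarrow> j = i"
        using coord_position_unique[OF P(2), of j k i] Crd i that P(1) by auto
      then show ?thesis
        using f that k(1)[OF \<open>l < m\<close>] Crd \<open>length x = m\<close> \<open>length y = m\<close> by auto
    qed
    then have "{j. j < length (f x) \<and> f x ! j \<noteq> f y ! j} = {i}" using len that i(1) by auto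
    then show ?thesis by (simp add: hamming_def)
  qed
  have out: "f x = []" if "length x \<noteq> m" for x using that by (simp add: P(3) slot_map_def)
  show ?thesis
    unfolding hat_hom_def is_map_def Ball_def verts_iff using mono inj ham len out by blast
qed

section \<open>Factorisation through a face of the target\<close>

lemma coords_ranks:
  "coords (map (\<lambda>j. if j \<in> F then Crd (card {i \<in> F. i < j}) else Cst (c j)) [0..<p])
     = [0..<card {i \<in> F. i < p}]"
proof (induction p)
  case (Suc p)
  have "{i \<in> F. i < Suc p} = (if p \<in> F then insert p {i \<in> F. i < p} else {i \<in> F. i < p})"
    by (auto simp: less_Suc_eq)
  then show ?case using Suc by simp
qed simp

text \<open>By monotonicity an output coordinate with equal values at bottom and top is constant;
  comparing weights leaves exactly \<open>n\<close> others. Numbering these gives the face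
  \<open>d\<close>, and reading them off gives \<open>g'\<close>.\<close>

lemma hat_hom_factor:
  assumes "hat_hom n p g"
  obtains d g' where "box_hom n p d" "hat_hom n n g'" "g = cmp n d g'"
proof -
  let ?z = "g (replicate n False)" and ?o = "g (replicate n True)"
  define F where "F = {j. j < p \<and> \<not> ?z ! j \<and> ?o ! j}"
  have lz: "length ?z = p" "length ?o = p" using hat_hom_length[OF assms] by simp_all
  have len: "length (g x) = p" if "length x = n" for x using hat_hom_length[OF assms that] .
  have zx: "leq ?z (g x)" and xo: "leq (g x) ?o" if "length x = n" for x
    using that by (intro hat_hom_mono[OF assms]; simp add: leq_def)+
  have off: "g x ! j = ?z ! j" if "length x = n" "j < p" "j \<notin> F" for x j
    using zx[OF that(1)] xo[OF that(1)] that lz len by (auto simp: leq_def F_def)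
  have "weight ?o = weight ?z + n" using hat_hom_weight[OF assms, of "replicate n True"] by simp
  moreover have "weight ?o = card ({i. i < p \<and> ?z ! i} \<union> F)"
    unfolding weight_def using zx[of "replicate n True"] lz
    by (intro arg_cong[of _ _ card]) (auto simp: leq_def F_def)
  moreover have "card ({i. i < p \<and> ?z ! i} \<union> F) = weight ?z + card F"
    unfolding weight_def lz by (subst card_Un_disjoint) (auto simp: F_def)
  ultimately have cF: "card F = n" by simp
  define P where "P = map (\<lambda>j. if j \<in> F then Crd (card {i \<in> F. i < j}) else Cst (?z ! j)) [0..<p]"
  have lP: "length P = p" by (simp add: P_def)
  have "{i \<in> F. i < p} = F" by (auto simp: F_def)
  then have cP: "coords P = [0..<n]" unfolding P_def coords_ranks by (simp add: cF)
  \<comment> \<open>\<open>pos\<close> inverts the numbering: it sends an index below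
    \<open>n\<close> to the free position that carries it.\<close>
  define pos where "pos k = (SOME i. i < p \<and> P ! i = Crd k)" for k
  have pos: "pos k < p" "P ! pos k = Crd k" if "k < n" for k
  proof -
    have "\<exists>i. i < p \<and> P ! i = Crd k" using coord_position_exists[OF cP that] lP by metis
    then show "pos k < p" "P ! pos k = Crd k"
      unfolding pos_def by (metis (mono_tags, lifting) someI_ex)+
  qed
  define g' where "g' x = (if length x = n then map (\<lambda>k. g x ! pos k) [0..<n] else [])" for x
  have g': "g x = slot_map n P (g' x)" if "length x = n" for x
  proof (rule nth_equalityI)
    show "length (g x) = length (slot_map n P (g' x))"
      using len[OF that] that by (simp add: slot_map_def g'_def lP)
  next
    fix j assume "j < length (g x)"
    then have j: "j < p" using len[OF that] by simp
    show "g x ! j = slot_map n P (g' x) ! j"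
    proof (cases "j \<in> F")
      case True
      then obtain k where k: "P ! j = Crd k" using j by (simp add: P_def)
      then have "k < n" using coord_less[OF cP] lP j by metis
      then have "pos k = j" using coord_position_unique[OF cP] pos k lP j by metis
      then show ?thesis using k j that \<open>k < n\<close> by (simp add: slot_map_def g'_def lP)
    next
      case False
      then have "P ! j = Cst (?z ! j)" using j by (simp add: P_def)
      then show ?thesis using off[OF that j False] j that by (simp add: slot_map_def g'_def lP)
    qed
  qed
  have box: "box_hom n p (slot_map n P)" using box_hom_slot_map[OF cP] lP by simp
  have eq: "g = cmp n (slot_map n P) g'"
    using g' hat_hom_outside[OF assms] by (auto simp: cmp_def)
  have l': "length (g' x) = n" if "length x = n" for x using that by (simp add: g'_def)
  have "leq (g' x) (g' y)" if "length x = n" "length y = n" "leq x y" for x y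
    using hat_hom_mono[OF assms that] that pos(1) len by (auto simp: leq_def g'_def)
  moreover have "g' x \<noteq> g' y" if "length x = n" "length y = n" "leq x y" "x \<noteq> y" for x y
  proof -
    have "g x \<noteq> g y" using assms that by (simp add: hat_hom_def)
    then show ?thesis using g' that by metis
  qed
  moreover have "hamming (g' x) (g' y) = 1" if "length x = n" "length y = n" "hamming x y = 1" for x y
  proof -
    have h: "hamming (g x) (g y) = 1" using assms that by (simp add: hat_hom_def)
    \<comment> \<open>Outside \<open>F\<close> the values of \<open>g\<close> are constant, so
      \<open>pos\<close> matches the changes of \<open>g'\<close> with all changes of
      \<open>g\<close>.\<close>
    have "bij_betw pos {k. k < length (g' x) \<and> g' x ! k \<noteq> g' y ! k}
             {j. j < length (g x) \<and> g x ! j \<noteq> g y ! j}"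
    proof (rule bij_betw_imageI)
      show "inj_on pos {k. k < length (g' x) \<and> g' x ! k \<noteq> g' y ! k}"
      proof (rule inj_onI)
        fix k l assume "k \<in> {k. k < length (g' x) \<and> g' x ! k \<noteq> g' y ! k}"
          "l \<in> {k. k < length (g' x) \<and> g' x ! k \<noteq> g' y ! k}" and e: "pos k = pos l"
        then have "k < n" "l < n" using l'[OF that(1)] by auto
        then have "Crd k = Crd l" using pos(2) e by metis
        then show "k = l" by simp
      qed
      show "pos ` {k. k < length (g' x) \<and> g' x ! k \<noteq> g' y ! k} = {j. j < length (g x) \<and> g x ! j \<noteq> g y ! j}"
      proof (intro equalityI subsetI)
        fix j assume "j \<in> {j. j < length (g x) \<and> g x ! j \<noteq> g y ! j}"
        then have j: "j < p" "g x ! j \<noteq> g y ! j" using len that by auto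
        then have "j \<in> F" using off that by metis
        then obtain k where k: "P ! j = Crd k" using j by (simp add: P_def)
        then have "k < n" using coord_less[OF cP] lP j by metis
        then have "pos k = j" using coord_position_unique[OF cP] pos k lP j by metis
        then show "j \<in> pos ` {k. k < length (g' x) \<and> g' x ! k \<noteq> g' y ! k}"
          using j that \<open>k < n\<close> by (intro image_eqI[of _ _ k]) (auto simp: g'_def)
      qed (use that pos len in \<open>auto simp: g'_def\<close>)
    qed
    from bij_betw_same_card[OF this] show ?thesis using h by (simp only: hamming_def)
  qed
  ultimately have "hat_hom n n g'"
    using l' by (auto simp: hat_hom_def is_map_def g'_def)
  then show ?thesis using that box eq by blast
qed

section \<open>Maps out of cubes of dimension at most one\<close>

lemma hat_endo_low:
  assumes "hat_hom n n g" "n \<le> 1" shows "g = idm n"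
proof (rule hat_hom_eqI[OF assms(1) hat_hom_idm])
  fix x :: vert assume "length x = n"
  \<comment> \<open>In these dimensions there is no vertex besides bottom and top, and both are
    fixed.\<close>
  then have "x = replicate n False \<or> x = replicate n True"
    using assms(2) by (cases x; cases n) auto
  then show "g x = idm n x" using hat_endo_bounds[OF assms(1)] by (auto simp: idm_def)
qed

lemma cmp_idm_right: "hat_hom m n f \<Longrightarrow> cmp m f (idm m) = f"
  using hat_hom_outside[of m n f] by (simp add: cmp_def idm_def fun_eq_iff)

lemma cmp_idm_left: "hat_hom m n f \<Longrightarrow> cmp m (idm n) f = f"
  using hat_hom_outside[of m n f] hat_hom_length[of m n f]
  by (simp add: cmp_def idm_def fun_eq_iff)

lemma cmp_assoc: "hat_hom k m g \<Longrightarrow> cmp k (cmp m f g') g = cmp k f (cmp k g' g)"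
  using hat_hom_length[of k m g] by (simp add: cmp_def fun_eq_iff)

text \<open>The endomap in the factorisation is the identity here. Hence the vertices and edges of a
  cube are the same in both categories of cubes.\<close>

lemma hat_box_low:
  assumes "hat_hom m n f" "m \<le> 1" shows "box_hom m n f"
proof -
  obtain d g' where d: "box_hom m n d" "hat_hom m m g'" "f = cmp m d g'"
    using hat_hom_factor[OF assms(1)] .
  then show ?thesis using hat_endo_low[OF d(2) assms(2)] cmp_idm_right[OF box_hat[OF d(1)]] by simp
qed

lemma box_hom_0_pt: "box_hom 0 n v \<longleftrightarrow> (\<exists>u. length u = n \<and> v = pt u)"
proof
  assume "box_hom 0 n v"
  then obtain P where P: "length P = n" "coords P = [0..<0]" "v = slot_map 0 P"
    by (rule box_hom_pattern)
  then have "v = pt (map (ev []) P)" by (auto simp: slot_map_def pt_def fun_eq_iff)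
  then show "\<exists>u. length u = n \<and> v = pt u" using P(1) by (metis length_map)
next
  assume "\<exists>u. length u = n \<and> v = pt u"
  then obtain u where u: "length u = n" "v = pt u" by blast
  have "coords (map Cst u) = [0..<0]" by (induction u) auto
  moreover have "slot_map 0 (map Cst u) = pt u"
    by (auto simp: slot_map_def pt_def fun_eq_iff comp_def)
  ultimately show "box_hom 0 n v" using box_hom_slot_map[of "map Cst u" 0] u by simp
qed

lemma cmp_pt: "cmp 0 f (pt u) = pt (f u)"
  by (auto simp: cmp_def pt_def fun_eq_iff)

lemma pt_Nil [simp]: "pt u [] = u"
  by (simp add: pt_def)

lemma pt_inject: "pt u = pt v \<longleftrightarrow> u = v"
  by (metis pt_Nil)

subsection \<open>Cubes of the left adjoint and their labels\<close>

lemma Lrel_refl [simp]: "Lrel X n r r"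
  by (simp add: Lrel_def)

lemma Lrel_sym: "Lrel X n r r' \<Longrightarrow> Lrel X n r' r"
proof -
  have "symp (sup (Lgen X n) (Lgen X n)\<inverse>\<inverse>)" by (auto intro: sympI)
  then show "Lrel X n r r' \<Longrightarrow> Lrel X n r' r"
    unfolding Lrel_def by (metis symp_rtranclp sympD)
qed

lemma Lrel_trans: "Lrel X n r s \<Longrightarrow> Lrel X n s t \<Longrightarrow> Lrel X n r t"
  unfolding Lrel_def by (rule rtranclp_trans)

lemma Lcls_eq_iff: "Lcls X n r = Lcls X n r' \<longleftrightarrow> Lrel X n r r'"
  unfolding Lcls_def by (auto intro: Lrel_trans Lrel_sym)

text \<open>Well-definedness on the quotient is reduced to generating pairs.\<close>

lemma Lrel_invariant:
  assumes gen: "\<And>p p' d x g. box_hom p' p d \<Longrightarrow> x \<in> cells X p \<Longrightarrow> hat_hom n p' g \<Longrightarrow>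
      F (p', act X p' p d x, g) = F (p, x, cmp n d g)"
    and "Lrel X n r r'"
  shows "F r = F r'"
proof -
  have "F s = F t" if "Lgen X n s t" for s t
    using that gen by (auto simp: Lgen_def)
  moreover from assms(2) have "(sup (Lgen X n) (Lgen X n)\<inverse>\<inverse>)\<^sup>*\<^sup>* r r'"
    by (simp add: Lrel_def)
  ultimately show ?thesis
    by (induction rule: rtranclp_induct[OF \<open>(sup (Lgen X n) (Lgen X n)\<inverse>\<inverse>)\<^sup>*\<^sup>* r r'\<close>]) fastforce+
qed

text \<open>Precomposition sends generating pairs to generating pairs by associativity, so the
  action of \<open>h\<close> is well defined on classes.\<close>

lemma Lrel_precomp:
  assumes "Lrel X n (p, x, g) (q, y, k)" "hat_hom m n h"
  shows "Lrel X m (p, x, cmp m g h) (q, y, cmp m k h)"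
proof -
  \<comment> \<open>Taking the class as value turns the relation into an equality, as
    \<open>Lrel_invariant\<close> expects.\<close>
  define F where "F = (\<lambda>(p, x, g). Lcls X m (p, x, cmp m g h))"
  have "F (p', act X p' p d x, g) = F (p, x, cmp n d g)"
    if "box_hom p' p d" "x \<in> cells X p" "hat_hom n p' g" for p p' d x g
  proof -
    have "Lgen X m (p', act X p' p d x, cmp m g h) (p, x, cmp m d (cmp m g h))"
      unfolding Lgen_def using that hat_hom_cmp[OF assms(2)] by blast
    then show ?thesis
      unfolding F_def prod.case Lcls_eq_iff cmp_assoc[OF assms(2)] Lrel_def by blast
  qed
  then have "F (p, x, g) = F (q, y, k)" using assms(1) by (rule Lrel_invariant)
  then show ?thesis by (simp add: F_def Lcls_eq_iff)
qed

lemma Lcls_gen: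
  assumes "box_hom p' p d" "x \<in> cells X p" "hat_hom n p' g"
  shows "Lcls X n (p', act X p' p d x, g) = Lcls X n (p, x, cmp n d g)"
proof -
  have "Lgen X n (p', act X p' p d x, g) (p, x, cmp n d g)"
    unfolding Lgen_def using assms by blast
  then show ?thesis unfolding Lcls_eq_iff Lrel_def by blast
qed

text \<open>\<open>Lact\<close> collects the results of all representatives; any single one already
  gives the whole class.\<close>

lemma Lact_Lcls:
  assumes "hat_hom m n h"
  shows "Lact X m n h (Lcls X n (p, x, g)) = Lcls X m (p, x, cmp m g h)"
proof (intro equalityI subsetI)
  fix r assume "r \<in> Lact X m n h (Lcls X n (p, x, g))"
  then obtain q y k where "Lrel X n (p, x, g) (q, y, k)" "Lrel X m (q, y, cmp m k h) r"
    by (auto simp: Lact_def Lcls_def)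
  then show "r \<in> Lcls X m (p, x, cmp m g h)"
    unfolding Lcls_def mem_Collect_eq by (rule Lrel_trans[OF Lrel_precomp[OF _ assms]])
next
  fix r assume "r \<in> Lcls X m (p, x, cmp m g h)"
  then show "r \<in> Lact X m n h (Lcls X n (p, x, g))"
    unfolding Lact_def Lcls_def mem_Collect_eq by (intro bexI[of _ "(p, x, g)"]) simp_all
qed

text \<open>The face part of \<open>g\<close> moves into \<open>x\<close> by the defining relation,
  which leaves an endomap.\<close>

lemma Lcls_normal_form:
  assumes "x \<in> cells X p" "hat_hom n p g"
  obtains d g' where "box_hom n p d" "hat_hom n n g'"
    "Lcls X n (p, x, g) = Lcls X n (n, act X n p d x, g')"
proof -
  obtain d g' where d: "box_hom n p d" "hat_hom n n g'" "g = cmp n d g'"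
    using hat_hom_factor[OF assms(2)] .
  then show ?thesis using that Lcls_gen[OF d(1) assms(1) d(2)] by metis
qed

lemma cells_Lpsh: "C \<in> cells (Lpsh X) n \<longleftrightarrow> (\<exists>p x g. x \<in> cells X p \<and> hat_hom n p g \<and> C = Lcls X n (p, x, g))"
  by (auto simp: Lpsh_def Lrep_def)

lemma cells_Llpsh: "C \<in> cells (Llpsh X) n \<longleftrightarrow> (\<exists>p x g. x \<in> cells X p \<and> hat_hom n p g \<and> C = Lcls X n (p, x, g))"
  by (auto simp: Llpsh_def Lrep_def)

lemma act_Lpsh [simp]: "act (Lpsh X) = Lact X"
  by (simp add: Lpsh_def)

lemma act_Llpsh [simp]: "act (Llpsh X) = Lact X"
  by (simp add: Llpsh_def)

lemma Lact_cells:
  assumes "C \<in> cells (Lpsh X) n" "hat_hom m n h"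
  shows "Lact X m n h C \<in> cells (Lpsh X) m"
  using assms(1) hat_hom_cmp[OF assms(2)] unfolding cells_Lpsh
  by (metis Lact_Lcls[OF assms(2)])

lemma Lact_cmp:
  assumes "C \<in> cells (Lpsh X) n" "hat_hom m n h" "hat_hom k m j"
  shows "Lact X k m j (Lact X m n h C) = Lact X k n (cmp k h j) C"
  using assms hat_hom_cmp[OF assms(3,2)]
  by (auto simp: cells_Lpsh Lact_Lcls cmp_assoc[OF assms(3)])

lemma Lact_idm:
  assumes "C \<in> cells (Lpsh X) n" shows "Lact X n n (idm n) C = C"
  using assms by (auto simp: cells_Lpsh Lact_Lcls[OF hat_hom_idm] cmp_idm_right)

section \<open>The separated quotient and its edges\<close>

lemma box_hom_face:
  assumes "1 \<le> i" "i \<le> Suc k" shows "box_hom k (Suc k) (face (Suc k) i a)"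
proof -
  have "cmp k (face (Suc k) i a) (idm k) = face (Suc k) i a"
    by (auto simp: cmp_def face_def idm_def fun_eq_iff)
  then show ?thesis using box_step[OF box_id assms, of a] by simp
qed

lemma shrel_Lpsh_cells:
  "shrel (Lpsh X) n x y \<Longrightarrow> x \<in> cells (Lpsh X) n \<and> y \<in> cells (Lpsh X) n"
  by (induction rule: shrel.induct) (auto simp: Lact_cells)

text \<open>Separation acts only from dimension 2 on, and every edge of such a cube lies in a facet,
  where the identification is already available. So \<open>sh\<close> merges no edges of
  \<open>Lpsh X\<close>.\<close>

lemma shrel_Lpsh_edges:
  "shrel (Lpsh X) n x y \<Longrightarrow> hat_hom 1 n e \<Longrightarrow> Lact X 1 n e x = Lact X 1 n e y"
proof (induction arbitrary: e rule: shrel.induct)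
  case (sh_cong n x y m h)
  then show ?case
    using shrel_Lpsh_cells[OF sh_cong(1)] hat_hom_cmp[OF sh_cong(4) sh_cong(2)]
    by (simp add: Lact_cmp)
next
  case (sh_sep n x y)
  \<comment> \<open>Being a box map, \<open>e\<close> is the identity, excluded by
    \<open>2 \<le> n\<close>, or ends with a face map.\<close>
  have "box_hom 1 n e" using hat_box_low sh_sep.prems by simp
  then show ?case
  proof cases
    case box_id
    then show ?thesis using sh_sep(1) by simp
  next
    case (box_step k f i a)
    have hf: "hat_hom k n (face n i a)" "hat_hom 1 k f"
      using box_hat box_hom_face box_step by auto
    have "Lact X 1 k f (Lact X k n (face n i a) x) = Lact X 1 k f (Lact X k n (face n i a) y)"
      using sh_sep(4) box_step hf(2) by simp
    then show ?thesis
      using Lact_cmp[OF sh_sep(2) hf] Lact_cmp[OF sh_sep(3) hf] box_step by simp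
  qed
qed simp_all

lemma shcls_eqD: "y \<in> cells Y n \<Longrightarrow> shcls Y n x = shcls Y n y \<Longrightarrow> shrel Y n x y"
  unfolding shcls_def by (auto intro: sh_refl)

lemma act_sh_shcls:
  assumes "x \<in> cells Y n" "hat_hom m n h"
  shows "act (sh Y) m n h (shcls Y n x) = shcls Y m (act Y m n h x)"
  using assms unfolding sh_def shcls_def
  by (auto intro: sh_trans sh_cong sh_refl)

definition word_class :: "nat \<Rightarrow> 'l lrep \<Rightarrow> 'l shcell" where
  "word_class n r = shcls (Lpsh bang) n (Lcls bang n r)"

lemma bang_cells [simp]: "w \<in> cells bang n \<longleftrightarrow> length w = n"
  by (simp add: bang_def)

lemma bang_act [simp]: "act bang m n f w = nths w (free_coords m n f)"
  by (simp add: bang_def)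

lemma word_class_in_cells:
  assumes "length w = p" "hat_hom n p g" shows "word_class n (p, w, g) \<in> cells shLbang n"
proof -
  have "Lcls bang n (p, w, g) \<in> cells (Lpsh bang) n" using assms by (auto simp: cells_Lpsh)
  then show ?thesis by (simp add: word_class_def shLbang_def sh_def)
qed

lemma act_word_class:
  assumes "length w = p" "hat_hom n p g" "hat_hom m n h"
  shows "act shLbang m n h (word_class n (p, w, g)) = word_class m (p, w, cmp m g h)"
proof -
  have "Lcls bang n (p, w, g) \<in> cells (Lpsh bang) n" using assms by (auto simp: cells_Lpsh)
  then show ?thesis
    unfolding word_class_def shLbang_def using assms(3) by (simp add: act_sh_shcls Lact_Lcls)
qed

lemma word_class_gen:
  assumes "box_hom p' p d" "length w = p" "hat_hom n p' g"
  shows "word_class n (p', nths w (free_coords p' p d), g) = word_class n (p, w, cmp n d g)"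
  unfolding word_class_def using Lcls_gen[OF assms(1) _ assms(3), of w bang] assms(2) by simp

lemma sig1_word_class: "sig1 a = word_class 1 (1, [a], idm 1)"
  by (simp add: sig1_def word_class_def)

lemma word_class_edge:
  assumes "hat_hom 1 p e" "length w = p" "nths w (free_coords 1 p e) = [a]"
  shows "word_class 1 (p, w, e) = sig1 a"
  using word_class_gen[OF hat_box_low[OF assms(1)] assms(2) hat_hom_idm] assms(3) cmp_idm_right[OF assms(1)]
  by (simp add: sig1_word_class)

lemma nths_1_idm: "nths [a] (free_coords 1 1 (idm 1)) = [a]"
  using length_nths_free_coords[OF box_id, of "[a]" 1] by (auto split: if_splits)

text \<open>Separation merges no edges, and the letter of an edge is invariant under
  \<open>Lrel\<close>. This lets the \<open>THE\<close> in \<open>trunc_hat\<close> recover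
  labels.\<close>

lemma sig1_inject: "sig1 a = sig1 b \<longleftrightarrow> a = b"
proof
  assume "sig1 a = sig1 b"
  let ?C = "\<lambda>a::'a. Lcls bang 1 (1, [a], idm 1)"
  have cell: "?C a \<in> cells (Lpsh bang) 1" for a
    unfolding cells_Lpsh using hat_hom_idm[of 1] by (intro exI conjI; (rule refl | simp))
  then have "shrel (Lpsh bang) 1 (?C a) (?C b)"
    using \<open>sig1 a = sig1 b\<close> unfolding sig1_def by (intro shcls_eqD)
  then have "?C a = ?C b"
    using shrel_Lpsh_edges[OF _ hat_hom_idm] cell by (metis Lact_idm)
  then have r: "Lrel bang 1 (1, [a], idm 1) (1, [b], idm 1)" by (simp add: Lcls_eq_iff)
  \<comment> \<open>\<open>F\<close> restricts the word along the edge \<open>g\<close>; its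
    invariance is functoriality of \<open>bang\<close>, available because \<open>g\<close> is a box
    map.\<close>
  define F where "F = (\<lambda>(p, w :: 'a list, g). nths w (free_coords 1 p g))"
  have "F (1, [a], idm 1) = F (1, [b], idm 1)"
  proof (rule Lrel_invariant[OF _ r])
    fix p p' d g and x :: "'a list"
    assume "box_hom p' p d" "hat_hom 1 p' g"
    then show "F (p', act bang p' p d x, g) = F (p, x, cmp 1 d g)"
      using hat_box_low[of 1 p' g] by (simp add: F_def nths_free_coords_cmp)
  qed
  then show "a = b" unfolding F_def prod.case nths_1_idm by simp
qed simp

text \<open>This says that \<open>lab X\<close> is a morphism to \<open>bang\<close>.\<close>

definition bang_labelled :: "('a, 'l list) lpsh \<Rightarrow> bool" where
  "bang_labelled X \<longleftrightarrow> (\<forall>p x. x \<in> cells X p \<longrightarrow> length (lab X p x) = p \<and>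
     (\<forall>p' d. box_hom p' p d \<longrightarrow> lab X p' (act X p' p d x) = nths (lab X p x) (free_coords p' p d)))"

text \<open>As \<open>lab X\<close> commutes with box maps, all representatives give the same label,
  so the \<open>SOME\<close> in \<open>Llpsh\<close> has only one candidate.\<close>

lemma lab_Llpsh:
  assumes "bang_labelled X"
  shows "lab (Llpsh X) n (Lcls X n (p, x, g)) = word_class n (p, lab X p x, g)"
proof -
  define F where "F = (\<lambda>(p, x, g). word_class n (p, lab X p x, g))"
  have inv: "F r = F r'" if "Lrel X n r r'" for r r'
  proof (rule Lrel_invariant[OF _ that])
    fix p p' d g x
    assume "box_hom p' p d" "hat_hom n p' g" "x \<in> cells X p"
    then show "F (p', act X p' p d x, g) = F (p, x, cmp n d g)"
      using assms by (simp add: F_def bang_labelled_def word_class_gen)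
  qed
  have "lab (Llpsh X) n (Lcls X n (p, x, g)) = (SOME c. \<exists>r\<in>Lcls X n (p, x, g). c = F r)"
    unfolding Llpsh_def F_def word_class_def by (simp add: case_prod_unfold)
  also have "\<dots> = F (p, x, g)"
  proof (rule some_equality)
    show "\<exists>r\<in>Lcls X n (p, x, g). F (p, x, g) = F r"
      by (rule bexI[of _ "(p, x, g)"]) (simp_all add: Lcls_def)
  next
    fix c assume "\<exists>r\<in>Lcls X n (p, x, g). c = F r"
    then show "c = F (p, x, g)" using inv by (force simp: Lcls_def)
  qed
  finally show ?thesis by (simp add: F_def)
qed

subsection \<open>One-dimensional labelled sets\<close>

text \<open>End points are required to be vertices so that injectivity of \<open>k0\<close> applies
  to them.\<close>

definition oiso :: "('v, 'e, 'l) oned \<Rightarrow> ('w, 'f, 'l) oned \<Rightarrow> ('v \<Rightarrow> 'w) \<Rightarrow> ('e \<Rightarrow> 'f) \<Rightarrow> bool" where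
  "oiso K K' k0 k1 \<longleftrightarrow> bij_betw k0 (oV K) (oV K') \<and> bij_betw k1 (oE K) (oE K') \<and>
     (\<forall>e\<in>oE K. src K e \<in> oV K \<and> tgt K e \<in> oV K \<and> src K' (k1 e) = k0 (src K e) \<and>
        tgt K' (k1 e) = k0 (tgt K e) \<and> ell K' (k1 e) = ell K e)"

text \<open>The aim is to recover an edge from its two end points; excluding loops keeps this true
  in fibered products.\<close>

definition osimple :: "('v, 'e, 'l) oned \<Rightarrow> bool" where
  "osimple K \<longleftrightarrow> (\<forall>e\<in>oE K. src K e \<noteq> tgt K e) \<and>
     (\<forall>e\<in>oE K. \<forall>e'\<in>oE K. src K e = src K e' \<and> tgt K e = tgt K e' \<longrightarrow> e = e')"

lemma oiso_osimple:
  assumes "oiso K K' k0 k1" "osimple K" shows "osimple K'"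
proof -
  have b: "bij_betw k0 (oV K) (oV K')" "bij_betw k1 (oE K) (oE K')"
    using assms(1) by (auto simp: oiso_def)
  have im: "oE K' = k1 ` oE K" using b(2) by (auto simp: bij_betw_def)
  have inj: "k0 v = k0 w \<longleftrightarrow> v = w" if "v \<in> oV K" "w \<in> oV K" for v w
    using b(1) that by (auto simp: bij_betw_def inj_on_def)
  show ?thesis
    using assms unfolding osimple_def im oiso_def by (auto simp: inj)
qed

lemma fprod_edges:
  "EL x y \<in> oE (fprod bar \<tau> K L) \<longleftrightarrow> x \<in> oE K \<and> y \<in> oV L"
  "ER v z \<in> oE (fprod bar \<tau> K L) \<longleftrightarrow> v \<in> oV K \<and> z \<in> oE L"
  "ES x z \<in> oE (fprod bar \<tau> K L) \<longleftrightarrow>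
     x \<in> oE K \<and> z \<in> oE L \<and> ell K x \<noteq> \<tau> \<and> bar (ell K x) = ell L z"
  by (auto simp: fprod_def)

lemma fprod_simps:
  "oV (fprod bar \<tau> K L) = oV K \<times> oV L"
  "src (fprod bar \<tau> K L) (EL x y) = (src K x, y)" "tgt (fprod bar \<tau> K L) (EL x y) = (tgt K x, y)"
  "src (fprod bar \<tau> K L) (ER v z) = (v, src L z)" "tgt (fprod bar \<tau> K L) (ER v z) = (v, tgt L z)"
  "src (fprod bar \<tau> K L) (ES x z) = (src K x, src L z)"
  "tgt (fprod bar \<tau> K L) (ES x z) = (tgt K x, tgt L z)"
  "ell (fprod bar \<tau> K L) (EL x y) = ell K x" "ell (fprod bar \<tau> K L) (ER v z) = ell L z"
  "ell (fprod bar \<tau> K L) (ES x z) = \<tau>"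
  by (simp_all add: fprod_def)

text \<open>Whether two edges synchronise depends only on their labels, which \<open>oiso\<close>
  preserves.\<close>

lemma oiso_fprod:
  assumes K: "oiso K K' k0 k1" and L: "oiso L L' l0 l1"
  shows "oiso (fprod bar \<tau> K L) (fprod bar \<tau> K' L') (map_prod k0 l0) (map_pedge k0 k1 l0 l1)"
proof -
  have b: "bij_betw k0 (oV K) (oV K')" "bij_betw k1 (oE K) (oE K')"
      "bij_betw l0 (oV L) (oV L')" "bij_betw l1 (oE L) (oE L')"
    using K L by (auto simp: oiso_def)
  have im: "oV K' = k0 ` oV K" "oE K' = k1 ` oE K" "oV L' = l0 ` oV L" "oE L' = l1 ` oE L"
    using b by (auto simp: bij_betw_def)
  have inj: "inj_on k0 (oV K)" "inj_on k1 (oE K)" "inj_on l0 (oV L)" "inj_on l1 (oE L)"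
    using b by (auto simp: bij_betw_def)
  have ell: "ell K' (k1 e) = ell K e" if "e \<in> oE K" for e using K that by (simp add: oiso_def)
  have ell': "ell L' (l1 e) = ell L e" if "e \<in> oE L" for e using L that by (simp add: oiso_def)
  have "bij_betw (map_prod k0 l0) (oV K \<times> oV L) (oV K' \<times> oV L')"
    using b by (intro bij_betw_map_prod)
  moreover have "bij_betw (map_pedge k0 k1 l0 l1) (oE (fprod bar \<tau> K L)) (oE (fprod bar \<tau> K' L'))"
  proof (rule bij_betw_imageI)
    show "inj_on (map_pedge k0 k1 l0 l1) (oE (fprod bar \<tau> K L))"
    proof (rule inj_onI)
      fix e e' assume "e \<in> oE (fprod bar \<tau> K L)" "e' \<in> oE (fprod bar \<tau> K L)"
        "map_pedge k0 k1 l0 l1 e = map_pedge k0 k1 l0 l1 e'"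
      then show "e = e'"
        by (cases e; cases e'; simp add: fprod_edges; metis inj inj_onD)
    qed
    show "map_pedge k0 k1 l0 l1 ` oE (fprod bar \<tau> K L) = oE (fprod bar \<tau> K' L')"
    proof (intro equalityI subsetI)
      fix e assume "e \<in> map_pedge k0 k1 l0 l1 ` oE (fprod bar \<tau> K L)"
      then obtain f where f: "f \<in> oE (fprod bar \<tau> K L)" "e = map_pedge k0 k1 l0 l1 f" by blast
      then show "e \<in> oE (fprod bar \<tau> K' L')"
        by (cases f) (auto simp: fprod_edges im ell ell')
    next
      fix e assume e: "e \<in> oE (fprod bar \<tau> K' L')"
      have "\<exists>f. f \<in> oE (fprod bar \<tau> K L) \<and> e = map_pedge k0 k1 l0 l1 f"
      proof (cases e)
        case (EL x y)
        then obtain x' y' where "x' \<in> oE K" "y' \<in> oV L" "x = k1 x'" "y = l0 y'"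
          using e unfolding EL fprod_edges im by blast
        then show ?thesis by (intro exI[of _ "EL x' y'"]) (simp add: EL fprod_edges)
      next
        case (ER x y)
        then obtain x' y' where "x' \<in> oV K" "y' \<in> oE L" "x = k0 x'" "y = l1 y'"
          using e unfolding ER fprod_edges im by blast
        then show ?thesis by (intro exI[of _ "ER x' y'"]) (simp add: ER fprod_edges)
      next
        case (ES x y)
        then obtain x' y' where "x' \<in> oE K" "y' \<in> oE L" "x = k1 x'" "y = l1 y'"
          using e unfolding ES fprod_edges im by blast
        then show ?thesis using e ell[of x'] ell'[of y']
          by (intro exI[of _ "ES x' y'"]) (simp add: ES fprod_edges)
      qed
      then show "e \<in> map_pedge k0 k1 l0 l1 ` oE (fprod bar \<tau> K L)" by blast
    qed
  qed
  moreover have "src (fprod bar \<tau> K L) e \<in> oV (fprod bar \<tau> K L) \<and>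
      tgt (fprod bar \<tau> K L) e \<in> oV (fprod bar \<tau> K L) \<and>
      src (fprod bar \<tau> K' L') (map_pedge k0 k1 l0 l1 e) = map_prod k0 l0 (src (fprod bar \<tau> K L) e) \<and>
      tgt (fprod bar \<tau> K' L') (map_pedge k0 k1 l0 l1 e) = map_prod k0 l0 (tgt (fprod bar \<tau> K L) e) \<and>
      ell (fprod bar \<tau> K' L') (map_pedge k0 k1 l0 l1 e) = ell (fprod bar \<tau> K L) e"
    if "e \<in> oE (fprod bar \<tau> K L)" for e
    using that K L unfolding oiso_def by (cases e) (simp_all add: fprod_edges fprod_simps)
  ultimately show ?thesis
    unfolding oiso_def by (simp add: fprod_simps(1))
qed

text \<open>Without loops the end points show which components move, hence which of the three kinds
  an edge has; its components are then determined in the factors.\<close>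

lemma osimple_fprod:
  assumes "osimple K" "osimple L" shows "osimple (fprod bar \<tau> K L)"
proof -
  have K: "src K e \<noteq> tgt K e" "src K e = src K e' \<Longrightarrow> tgt K e = tgt K e' \<Longrightarrow> e = e'"
    if "e \<in> oE K" "e' \<in> oE K" for e e' using assms(1) that by (auto simp: osimple_def)
  have L: "src L e \<noteq> tgt L e" "src L e = src L e' \<Longrightarrow> tgt L e = tgt L e' \<Longrightarrow> e = e'"
    if "e \<in> oE L" "e' \<in> oE L" for e e' using assms(2) that by (auto simp: osimple_def)
  have "src (fprod bar \<tau> K L) e \<noteq> tgt (fprod bar \<tau> K L) e" if "e \<in> oE (fprod bar \<tau> K L)" for e
    using that assms by (cases e) (auto simp: fprod_edges fprod_simps osimple_def)
  moreover have "e = e'" if "e \<in> oE (fprod bar \<tau> K L)" "e' \<in> oE (fprod bar \<tau> K L)"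
      "src (fprod bar \<tau> K L) e = src (fprod bar \<tau> K L) e'"
      "tgt (fprod bar \<tau> K L) e = tgt (fprod bar \<tau> K L) e'" for e e'
    using that by (cases e; cases e'; simp add: fprod_edges fprod_simps; metis K L)
  ultimately show ?thesis unfolding osimple_def by blast
qed

section \<open>Edges of the labelled cubes\<close>

lemma face_1: "face 1 1 b = pt [b]"
  by (auto simp: face_def pt_def fun_eq_iff)

lemma box_hom_face_1: "box_hom 0 1 (face 1 1 b)"
  using box_hom_face[of 1 0 b] by simp

lemma edge_eqI:
  assumes "hat_hom 1 n e" "hat_hom 1 n e'"
    "cmp 0 e (face 1 1 False) = cmp 0 e' (face 1 1 False)"
    "cmp 0 e (face 1 1 True) = cmp 0 e' (face 1 1 True)"
  shows "e = e'"
proof (rule hat_hom_eqI[OF assms(1,2)])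
  fix x :: vert assume "length x = 1"
  then have "x = [False] \<or> x = [True]" by (cases x) auto
  then show "e x = e' x"
    using assms(3,4) unfolding face_1 cmp_pt pt_inject by auto
qed

lemma edge_ends_neq:
  assumes "hat_hom 1 n e" shows "cmp 0 e (face 1 1 False) \<noteq> cmp 0 e (face 1 1 True)"
proof -
  have "e [False] \<noteq> e [True]" using assms by (simp add: hat_hom_def leq_def)
  then show ?thesis unfolding face_1 cmp_pt pt_inject .
qed

lemma osimple_lcube: "osimple (trunc_box (lcube as))"
  unfolding osimple_def trunc_box_def lcube_def oned.simps lpsh.simps Ball_def mem_Collect_eq
  by (blast intro: box_hat edge_eqI dest: edge_ends_neq[OF box_hat])

lemma bang_labelled_lcube: "bang_labelled (lcube as)"
  by (simp add: bang_labelled_def lcube_def length_nths_free_coords nths_free_coords_cmp)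

lemma lcube_simps [simp]:
  "x \<in> cells (lcube as) k \<longleftrightarrow> box_hom k (length as) x"
  "act (lcube as) m k g x = cmp m x g"
  "lab (lcube as) k x = nths as (free_coords k (length as) x)"
  by (simp_all add: lcube_def)

text \<open>Composing \<open>x\<close> with \<open>g\<close> is invariant under the relation: it is
  the comparison of \<open>L\<close> of a cube with the representable presheaf of
  adjacency-preserving maps.\<close>

lemma Lcls_lcube_eqD:
  assumes "Lcls (lcube as) n (n, x, idm n) = Lcls (lcube as) n (n, y, idm n)"
    "box_hom n (length as) x" "box_hom n (length as) y"
  shows "x = y"
proof -
  define F where "F = (\<lambda>(p :: nat, x, g). cmp n x g)"
  have "F (n, x, idm n) = F (n, y, idm n)"
  proof (rule Lrel_invariant)
    show "Lrel (lcube as) n (n, x, idm n) (n, y, idm n)" using assms(1) by (simp add: Lcls_eq_iff)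
  next
    fix p p' d g and x :: cmap
    assume "hat_hom n p' g"
    then show "F (p', act (lcube as) p' p d x, g) = F (p, x, cmp n d g)"
      by (simp add: F_def cmp_assoc)
  qed
  then show ?thesis
    using assms(2,3) by (simp add: F_def cmp_idm_right[OF box_hat])
qed

text \<open>In these dimensions the endomap of the normal form is the identity, so the left adjoint
  adds no vertices or edges.\<close>

lemma cells_Llpsh_low:
  assumes "n \<le> 1" "\<And>p d x. box_hom n p d \<Longrightarrow> x \<in> cells X p \<Longrightarrow> act X n p d x \<in> cells X n"
  shows "cells (Llpsh X) n = (\<lambda>x. Lcls X n (n, x, idm n)) ` cells X n"
proof (intro equalityI subsetI)
  fix C assume "C \<in> cells (Llpsh X) n"
  then obtain p x g where x: "x \<in> cells X p" "hat_hom n p g" "C = Lcls X n (p, x, g)"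
    unfolding cells_Llpsh by blast
  obtain d g' where d: "box_hom n p d" "hat_hom n n g'" "C = Lcls X n (n, act X n p d x, g')"
    using Lcls_normal_form[OF x(1,2)] x(3) by metis
  then have "g' = idm n" using hat_endo_low assms(1) by blast
  then show "C \<in> (\<lambda>x. Lcls X n (n, x, idm n)) ` cells X n"
    using d assms(2)[OF d(1) x(1)] by blast
next
  fix C assume "C \<in> (\<lambda>x. Lcls X n (n, x, idm n)) ` cells X n"
  then show "C \<in> cells (Llpsh X) n" unfolding cells_Llpsh using hat_hom_idm by blast
qed

lemma ell_lcube:
  assumes "box_hom 1 (length as) e"
  shows "nths as (free_coords 1 (length as) e) = [hd (nths as (free_coords 1 (length as) e))]"
  using length_nths_free_coords[OF assms refl]
  by (cases "nths as (free_coords 1 (length as) e)") auto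

text \<open>It allows the fibered product on the right-hand side to be replaced by the one built
  from box maps.\<close>

lemma oiso_lcube:
  "oiso (trunc_box (lcube as)) (trunc_hat (Llpsh (lcube as)))
     (\<lambda>v. Lcls (lcube as) 0 (0, v, idm 0)) (\<lambda>e. Lcls (lcube as) 1 (1, e, idm 1))"
proof -
  let ?c = "\<lambda>n x. Lcls (lcube as) n (n, x, idm n)"
  have bij: "bij_betw (?c n) (cells (lcube as) n) (cells (Llpsh (lcube as)) n)" if "n \<le> 1" for n
  proof (rule bij_betw_imageI)
    show "inj_on (?c n) (cells (lcube as) n)"
      by (rule inj_onI) (auto dest: Lcls_lcube_eqD)
    show "?c n ` cells (lcube as) n = cells (Llpsh (lcube as)) n"
      using cells_Llpsh_low[OF that, of "lcube as"] box_hom_cmp by auto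
  qed
  have end': "Lact (lcube as) 0 1 (face 1 1 b) (?c 1 e) = ?c 0 (cmp 0 e (face 1 1 b))"
    if "box_hom 1 (length as) e" for e b
  proof -
    have f: "hat_hom 0 1 (face 1 1 b)" using box_hat box_hom_face_1 by blast
    have "?c 0 (cmp 0 e (face 1 1 b)) = Lcls (lcube as) 0 (1, e, cmp 0 (face 1 1 b) (idm 0))"
      using Lcls_gen[OF box_hom_face_1 _ hat_hom_idm, of e "lcube as" b] that by simp
    then show ?thesis
      by (simp add: Lact_Lcls[OF f] cmp_idm_left[OF f] cmp_idm_right[OF f] del: One_nat_def)
  qed
  have ell': "(THE a. sig1 a = lab (Llpsh (lcube as)) 1 (?c 1 e)) =
      hd (nths as (free_coords 1 (length as) e))" if e: "box_hom 1 (length as) e" for e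
  proof -
    let ?w = "nths as (free_coords 1 (length as) e)"
    have "lab (Llpsh (lcube as)) 1 (?c 1 e) = word_class 1 (1, ?w, idm 1)"
      by (simp add: lab_Llpsh[OF bang_labelled_lcube])
    also have "\<dots> = sig1 (hd ?w)"
      using ell_lcube[OF e] by (metis sig1_word_class)
    finally show ?thesis by (simp add: sig1_inject)
  qed
  show ?thesis
    unfolding oiso_def trunc_box_def trunc_hat_def
    using bij[of 0] bij[of 1] end' ell' box_hom_cmp[OF box_hom_face_1] by simp
qed

subsection \<open>Non-twisted maps\<close>

text \<open>Asking for earlier occurrences of all smaller indices encodes the order of first
  occurrences without \<open>LEAST\<close>, in a form stable under substitution.\<close>

definition nontwisted_slots :: "nat \<Rightarrow> slot list \<Rightarrow> bool" where
  "nontwisted_slots n P \<longleftrightarrow> (\<forall>i. Crd i \<in> set P \<longleftrightarrow> i < n) \<and>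
     (\<forall>k j. k < length P \<and> P ! k = Crd j \<longrightarrow> (\<forall>i<j. \<exists>k'<k. P ! k' = Crd i))"

lemma nontwisted_slots_box:
  assumes "coords P = [0..<m]" shows "nontwisted_slots m P"
proof -
  have "\<exists>k'<k. P ! k' = Crd i" if k: "k < length P" "P ! k = Crd j" and "i < j" for i j k
  proof -
    have "i < m" using coord_less[OF assms k] that(3) by simp
    then obtain k' where k': "k' < length P" "P ! k' = Crd i"
      using coord_position_exists[OF assms] by blast
    have "k' < k"
    proof (rule ccontr)
      assume "\<not> k' < k"
      then have "card {l. l < k \<and> (\<exists>k. P ! l = Crd k)} \<le> card {l. l < k' \<and> (\<exists>k. P ! l = Crd k)}"
        by (intro card_mono) auto
      then show False
        using coord_eq_rank[OF assms k] coord_eq_rank[OF assms k'] that(3) by simp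
    qed
    then show ?thesis using k' by blast
  qed
  moreover have "Crd i \<in> set P \<longleftrightarrow> i < m" for i using set_coords[of i P] assms by simp
  ultimately show ?thesis unfolding nontwisted_slots_def by blast
qed

text \<open>It covers both the composite that defines a non-twisted map and the restriction of such
  a map along a box map.\<close>

lemma nontwisted_slots_subst:
  assumes P: "nontwisted_slots (length R) P" and R: "nontwisted_slots n R"
  shows "nontwisted_slots n (map (slot_subst R) P)"
proof -
  have inR: "i < length R" if "k < length P" "P ! k = Crd i" for i k
    using P that nth_mem[of k P] unfolding nontwisted_slots_def by metis
  have *: "\<exists>l. P ! k = Crd l \<and> l < length R \<and> R ! l = Crd i"
    if "k < length P" "slot_subst R (P ! k) = Crd i" for i k
    using that inR[of k] by (cases "P ! k") auto
  have "Crd i \<in> set (map (slot_subst R) P) \<longleftrightarrow> i < n" for i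
  proof
    assume "Crd i \<in> set (map (slot_subst R) P)"
    then obtain k where "k < length P" "slot_subst R (P ! k) = Crd i"
      by (auto simp: in_set_conv_nth)
    then obtain l where "l < length R" "R ! l = Crd i" using * by blast
    then show "i < n" using R nth_mem[of l R] unfolding nontwisted_slots_def by metis
  next
    assume "i < n"
    then have "Crd i \<in> set R" using R unfolding nontwisted_slots_def by blast
    then obtain l where l: "l < length R" "R ! l = Crd i" by (auto simp: in_set_conv_nth)
    then have "Crd l \<in> set P" using P unfolding nontwisted_slots_def by blast
    then have "slot_subst R (Crd l) \<in> set (map (slot_subst R) P)" by (simp del: slot_subst.simps)
    then show "Crd i \<in> set (map (slot_subst R) P)" using l by simp
  qed
  moreover have "\<exists>k'<k. map (slot_subst R) P ! k' = Crd i"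
    if "k < length (map (slot_subst R) P)" "map (slot_subst R) P ! k = Crd j" "i < j" for i j k
  proof -
    have k: "k < length P" "slot_subst R (P ! k) = Crd j" using that by simp_all
    obtain l where l: "P ! k = Crd l" "l < length R" "R ! l = Crd j" using *[OF k] by blast
    \<comment> \<open>The smaller index occurs earlier in \<open>R\<close>, and \<open>P\<close>
      mentions that slot of \<open>R\<close> before position \<open>k\<close>.\<close>
    then obtain l' where l': "l' < l" "R ! l' = Crd i"
      using R \<open>i < j\<close> unfolding nontwisted_slots_def by blast
    then obtain k' where "k' < k" "P ! k' = Crd l'"
      using P k(1) l(1) unfolding nontwisted_slots_def by blast
    then show ?thesis using k(1) l' by (intro exI[of _ k']) simp
  qed
  ultimately show ?thesis unfolding nontwisted_slots_def by blast
qed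

text \<open>The inner map is a list of coordinate slots without constants, the outer one the list of
  a box map; substitution gives \<open>P\<close>.\<close>

lemma nontwisted_pattern:
  assumes "nontwisted n p h"
  obtains P where "length P = p" "nontwisted_slots n P" "\<And>u. length u = n \<Longrightarrow> h u = map (ev u) P"
proof -
  obtain q \<psi> "is" where box: "box_hom q p \<psi>" and len: "length is = q" and set: "set is = {0..<n}"
    and ord: "\<And>i j. i < j \<Longrightarrow> j < n \<Longrightarrow> first_occ is i < first_occ is j"
    and h: "\<And>u. length u = n \<Longrightarrow> h u = \<psi> (map (\<lambda>i. u ! i) is)"
    using assms by (auto simp: nontwisted_def)
  obtain Q where Q: "length Q = p" "coords Q = [0..<q]" "\<psi> = slot_map q Q"
    using box by (rule box_hom_pattern)
  let ?R = "map Crd is"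
  have first: "first_occ is i < length is \<and> is ! first_occ is i = i" if "i < n" for i
  proof -
    have "i \<in> set is" using that set by simp
    then obtain k where "k < length is \<and> is ! k = i" by (auto simp: in_set_conv_nth)
    then show ?thesis unfolding first_occ_def by (rule LeastI)
  qed
  have "\<exists>k'<k. ?R ! k' = Crd i" if k: "k < length ?R" "?R ! k = Crd j" and "i < j" for i j k
  proof -
    have kj: "k < length is" "is ! k = j" using k by auto
    then have "j < n" using set nth_mem[of k "is"] by auto
    then have "first_occ is i < first_occ is j" using ord \<open>i < j\<close> by simp
    also have "first_occ is j \<le> k" unfolding first_occ_def using kj by (intro Least_le) simp
    finally have "first_occ is i < k" .
    then show ?thesis using first[of i] \<open>i < j\<close> \<open>j < n\<close> by (intro exI[of _ "first_occ is i"]) simp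
  qed
  moreover have "Crd i \<in> set ?R \<longleftrightarrow> i < n" for i using set by auto
  ultimately have "nontwisted_slots n ?R" unfolding nontwisted_slots_def by blast
  moreover have "nontwisted_slots (length ?R) Q" using nontwisted_slots_box[OF Q(2)] len by simp
  ultimately have "nontwisted_slots n (map (slot_subst ?R) Q)" by (intro nontwisted_slots_subst)
  moreover have "h u = map (ev u) (map (slot_subst ?R) Q)" if "length u = n" for u
  proof -
    have "ev (map (\<lambda>i. u ! i) is) s = ev u (slot_subst ?R s)" if "s \<in> set Q" for s
    proof -
      have "i < length ?R" if "s = Crd i" for i
        using \<open>s \<in> set Q\<close> that set_coords[of i Q] Q(2) len by simp
      from ev_subst[of s ?R u, OF this] show ?thesis by (simp add: comp_def)
    qed
    then show ?thesis using h[OF that] len by (simp add: Q(3) slot_map_def)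
  qed
  ultimately show ?thesis using that[of "map (slot_subst ?R) Q"] Q(1) by simp
qed

text \<open>The coordinates of an adjacency-preserving endomap are non-constant and pairwise distinct,
  so the positions of their first occurrences in the list of coordinates determine their order.\<close>
lemma nontwisted_slots_unique:
  assumes P: "nontwisted_slots n P" and P': "nontwisted_slots n P'" and g: "hat_hom n n g" and g': "hat_hom n n g'"
    and eq: "\<And>u. length u = n \<Longrightarrow> map (ev (g u)) P = map (ev (g' u)) P'"
  shows "P = P' \<and> g = g'"
proof -
  have len: "length P = length P'"
    using arg_cong[OF eq[of "replicate n False"], of length] by simp
  have eqn: "ev (g u) (P ! k) = ev (g' u) (P' ! k)" if "length u = n" "k < length P" for u k
    using arg_cong[OF eq[OF that(1)], of "\<lambda>l. l ! k"] that len by simp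
  have lt: "i < n" if "k < length Q" "Q ! k = Crd i" "nontwisted_slots n Q" for k i Q
    using that nth_mem[of k Q] unfolding nontwisted_slots_def by metis
  \<comment> \<open>Both conclusions are proved together by strong induction: equality of the
    earlier coordinate functions is what forces the next index.\<close>
  have main: "P ! k = P' ! k \<and> (\<forall>i. P ! k = Crd i \<longrightarrow> (\<forall>u. length u = n \<longrightarrow> g u ! i = g' u ! i))"
    if "k < length P" for k
    using that
  proof (induction k rule: less_induct)
    case (less k)
    have z: "g (replicate n False) = replicate n False" "g' (replicate n False) = replicate n False"
      and o: "g (replicate n True) = replicate n True" "g' (replicate n True) = replicate n True"
      using hat_endo_bounds g g' by auto
    \<comment> \<open>Endomaps fix bottom and top, and these two vertices tell constants from
      coordinates.\<close>
    have ends: "ev (replicate n b) (P ! k) = ev (replicate n b) (P' ! k)" for b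
      using eqn[of "replicate n b" k] z o less.prems by (cases b) auto
    show ?case
    proof (cases "P ! k")
      case (Cst b)
      moreover have "P' ! k = Cst b"
        using ends[of True] ends[of False] Cst lt[of k P'] P' less.prems len by (cases "P' ! k") auto
      ultimately show ?thesis by simp
    next
      case (Crd i)
      have i: "i < n" using lt[OF less.prems Crd P] .
      obtain j where j: "P' ! k = Crd j"
        using ends[of True] ends[of False] Crd i by (cases "P' ! k") auto
      have jn: "j < n" using lt[of k P', OF _ j P'] less.prems len by simp
      have ij: "g u ! i = g' u ! j" if "length u = n" for u
        using eqn[OF that less.prems] Crd j by simp
      \<comment> \<open>If the indices differ, the smaller one occurs earlier in one of the lists.
        There the induction hypothesis matches the coordinate functions, so one endomap would have
        two equal ones.\<close>
      have "i = j"
      proof (rule ccontr)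
        assume "i \<noteq> j"
        then consider "i < j" | "j < i" by linarith
        then show False
        proof cases
          case 1
          then obtain k' where k': "k' < k" "P' ! k' = Crd i"
            using P' j less.prems len unfolding nontwisted_slots_def by metis
          then have "P ! k' = Crd i" "\<And>u. length u = n \<Longrightarrow> g u ! i = g' u ! i"
            using less.IH[of k'] less.prems by auto
          then have "\<And>u. length u = n \<Longrightarrow> g' u ! i = g' u ! j" using ij by metis
          then show False using hat_endo_coords_distinct[OF g' i jn \<open>i \<noteq> j\<close>] by blast
        next
          case 2
          then obtain k' where k': "k' < k" "P ! k' = Crd j"
            using P Crd less.prems unfolding nontwisted_slots_def by metis
          then have "\<And>u. length u = n \<Longrightarrow> g u ! j = g' u ! j"
            using less.IH[of k'] less.prems by auto
          then have "\<And>u. length u = n \<Longrightarrow> g u ! i = g u ! j" using ij by metis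
          then show False using hat_endo_coords_distinct[OF g i jn \<open>i \<noteq> j\<close>] by blast
        qed
      qed
      then show ?thesis using Crd j ij by simp
    qed
  qed
  have "P = P'" using len main by (intro nth_equalityI) auto
  moreover have "g = g'"
  proof (rule hat_hom_eqI[OF g g'])
    fix u :: vert assume u: "length u = n"
    show "g u = g' u"
    proof (rule nth_equalityI)
      show "length (g u) = length (g' u)" using hat_hom_length g g' u by metis
      fix i assume "i < length (g u)"
      then have "i < n" using hat_hom_length[OF g u] by simp
      then obtain k where "k < length P" "P ! k = Crd i"
        using P unfolding nontwisted_slots_def by (metis in_set_conv_nth)
      then show "g u ! i = g' u ! i" using main u by blast
    qed
  qed
  ultimately show ?thesis ..
qed

section \<open>Cubes determined by their vertices\<close>

lemma nths_single: "i < length w \<Longrightarrow> nths w {i} = [w ! i]"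
proof (induction w arbitrary: i)
  case (Cons a w)
  then show ?case by (cases i) (auto simp: nths_Cons)
qed simp

lemma box_edge_direction:
  assumes "i < n" obtains e where "box_hom 1 n e" "free_coords 1 n e = {i}"
proof -
  let ?P = "replicate i (Cst False) @ Crd 0 # replicate (n - Suc i) (Cst False)"
  have "coords (replicate k (Cst False)) = []" for k by (induction k) auto
  then have c: "coords ?P = [0..<1]" by simp
  have l: "length ?P = n" using assms by simp
  have "(\<exists>k. ?P ! j = Crd k) \<longleftrightarrow> j = i" if "j < n" for j
    using that by (cases j i rule: linorder_cases) (auto simp: nth_append nth_Cons')
  then have "free_coords 1 n (slot_map 1 ?P) = {i}"
    using free_coords_slot_map[OF c] assms unfolding l by auto
  then show ?thesis using that box_hom_slot_map[OF c] l by simp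
qed

text \<open>Vertices determine edges by \<open>osimple\<close>, and one edge in each coordinate
  direction reveals each letter of the word.\<close>

lemma box_cosk_cells_eqI:
  assumes K: "osimple K" and c: "(w, f0, f1) \<in> box_cosk_cells K n" "(w', f0', f1') \<in> box_cosk_cells K n"
    and f0: "\<And>u. length u = n \<Longrightarrow> f0 (pt u) = f0' (pt u)"
  shows "(w, f0, f1) = (w', f0', f1')"
proof -
  have v: "f0 v = f0' v" for v
    using f0 c by (cases "box_hom 0 n v") (auto simp: box_cosk_cells_def box_hom_0_pt)
  have e: "f1 e = f1' e" for e
  proof (cases "box_hom 1 n e")
    case True
    then have "f1 e \<in> oE K" "f1' e \<in> oE K" "src K (f1 e) = src K (f1' e)" "tgt K (f1 e) = tgt K (f1' e)"
      using c v by (auto simp: box_cosk_cells_def)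
    then show ?thesis using K unfolding osimple_def by blast
  qed (use c in \<open>auto simp: box_cosk_cells_def\<close>)
  have len: "length w = n" "length w' = n" using c by (auto simp: box_cosk_cells_def)
  have "w ! i = w' ! i" if "i < n" for i
  proof -
    obtain e' where e': "box_hom 1 n e'" "free_coords 1 n e' = {i}"
      using box_edge_direction[OF \<open>i < n\<close>] .
    then have "[ell K (f1 e')] = nths w {i}" "[ell K (f1' e')] = nths w' {i}"
      using c by (auto simp: box_cosk_cells_def)
    then show ?thesis using e[of e'] len that by (simp add: nths_single)
  qed
  then have "w = w'" using len by (intro nth_equalityI) auto
  then show ?thesis using v e by (simp add: fun_eq_iff)
qed

lemma box_cosk_act_cells:
  assumes d: "box_hom m n d" and c: "c \<in> box_cosk_cells K n"
  shows "box_cosk_act m n d c \<in> box_cosk_cells K m"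
proof -
  obtain w f0 f1 where c': "c = (w, f0, f1)" by (cases c)
  have v: "f0 (cmp 0 d v) \<in> oV K" if "box_hom 0 m v" for v
    using c box_hom_cmp[OF that d] by (auto simp: c' box_cosk_cells_def)
  have e: "f1 (cmp 1 d e) \<in> oE K \<and> src K (f1 (cmp 1 d e)) = f0 (cmp 0 d (cmp 0 e (face 1 1 False))) \<and>
      tgt K (f1 (cmp 1 d e)) = f0 (cmp 0 d (cmp 0 e (face 1 1 True))) \<and>
      [ell K (f1 (cmp 1 d e))] = nths (nths w (free_coords m n d)) (free_coords 1 m e)"
    if "box_hom 1 m e" for e
    using c box_hom_cmp[OF that d] cmp_assoc[OF box_hat[OF box_hom_face_1], of d e]
      nths_free_coords_cmp[OF that d, of w]
    by (auto simp: c' box_cosk_cells_def)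
  have "length (nths w (free_coords m n d)) = m"
    using c length_nths_free_coords[OF d] by (auto simp: c' box_cosk_cells_def)
  then show ?thesis
    using v e box_hom_cmp[OF box_hom_face_1] by (simp add: c' box_cosk_act_def box_cosk_cells_def)
qed

lemma box_hom_le: "box_hom m n f \<Longrightarrow> m \<le> n"
  by (induction rule: box_hom.induct) auto

lemma COSK_simps:
  "c \<in> cells (COSK ident p K) n \<longleftrightarrow> c \<in> box_cosk_cells K n \<and>
     (n \<le> 1 \<or> nontwisted n p (\<lambda>u. ident (fst (snd c) (pt u))))"
  "act (COSK ident p K) = box_cosk_act"
  "lab (COSK ident p K) n c = fst c"
  by (auto simp: COSK_def)

lemma bang_labelled_COSK: "bang_labelled (COSK ident p K)"
  by (auto simp: bang_labelled_def COSK_simps box_cosk_cells_def box_cosk_act_def)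

text \<open>Absorbing the face part keeps the order of first occurrences, by substitution into the
  list of the box map. Only the list \<open>P\<close> is recorded, as it is what gets
  compared.\<close>

lemma cells_Llpsh_COSK_normal_form:
  assumes "C \<in> cells (Llpsh (COSK ident p K)) n"
  obtains w f0 f1 g where "(w, f0, f1) \<in> box_cosk_cells K n" "hat_hom n n g"
    "C = Lcls (COSK ident p K) n (n, (w, f0, f1), g)"
    "n \<le> 1 \<or> (\<exists>P. length P = p \<and> nontwisted_slots n P \<and> (\<forall>u. length u = n \<longrightarrow> ident (f0 (pt u)) = map (ev u) P))"
proof -
  obtain q x k where x: "x \<in> cells (COSK ident p K) q" "hat_hom n q k"
      "C = Lcls (COSK ident p K) n (q, x, k)"
    using assms unfolding cells_Llpsh by blast
  obtain d g where d: "box_hom n q d" "hat_hom n n g"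
      "C = Lcls (COSK ident p K) n (n, box_cosk_act n q d x, g)"
    using Lcls_normal_form[OF x(1,2)] x(3) by (metis COSK_simps(2))
  obtain v h0 h1 where x': "x = (v, h0, h1)" by (cases x)
  obtain w f0 f1 where y: "box_cosk_act n q d x = (w, f0, f1)" by (cases "box_cosk_act n q d x")
  have "(w, f0, f1) \<in> box_cosk_cells K n"
    using box_cosk_act_cells[OF d(1), of x K] x(1) y by (simp add: COSK_simps)
  moreover have "\<exists>P. length P = p \<and> nontwisted_slots n P \<and> (\<forall>u. length u = n \<longrightarrow> ident (f0 (pt u)) = map (ev u) P)"
    if n: "\<not> n \<le> 1"
  proof -
    \<comment> \<open>The box map \<open>d\<close> gives \<open>n \<le> q\<close>, so
      \<open>q\<close> is at least 2 and the condition of \<open>COSK\<close> applies to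
      \<open>x\<close>.\<close>
    have "nontwisted q p (\<lambda>u. ident (h0 (pt u)))"
      using x(1) box_hom_le[OF d(1)] n by (auto simp: COSK_simps x')
    then obtain P where P: "length P = p" "nontwisted_slots q P"
        "\<And>u. length u = q \<Longrightarrow> ident (h0 (pt u)) = map (ev u) P"
      by (rule nontwisted_pattern) blast
    obtain R where R: "length R = q" "coords R = [0..<n]" "d = slot_map n R"
      using d(1) by (rule box_hom_pattern)
    have "ident (f0 (pt u)) = map (ev u) (map (slot_subst R) P)" if u: "length u = n" for u
    proof -
      have "box_hom 0 n (pt u)" using u box_hom_0_pt by blast
      then have "f0 (pt u) = h0 (pt (d u))" using y by (auto simp: x' box_cosk_act_def cmp_pt)
      then have "ident (f0 (pt u)) = map (ev (d u)) P"
        using P(3) hat_hom_length[OF box_hat[OF d(1)] u] by simp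
      moreover have "ev (d u) s = ev u (slot_subst R s)" if "s \<in> set P" for s
        using that P(2) R u unfolding nontwisted_slots_def by (auto simp: slot_map_def intro!: ev_subst)
      ultimately show ?thesis by simp
    qed
    moreover have "nontwisted_slots n (map (slot_subst R) P)"
      using P(2) R(1) nontwisted_slots_box[OF R(2)] by (intro nontwisted_slots_subst) simp_all
    ultimately show ?thesis using P(1) by (intro exI[of _ "map (slot_subst R) P"]) simp
  qed
  ultimately show ?thesis using that d y by metis
qed

subsection \<open>The comparison map\<close>

text \<open>Although \<open>f0\<close> and \<open>f1\<close> are specified on box maps only,
  \<open>cmp 0 g v\<close> and \<open>cmp 1 g e\<close> are box maps by \<open>hat_box_low\<close>.
  The \<open>undefined\<close> branches match those of \<open>hat_cosk_cells\<close>.\<close>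

definition cosk_image :: "('v \<Rightarrow> 'w) \<Rightarrow> ('e \<Rightarrow> 'f) \<Rightarrow> nat \<Rightarrow>
    nat \<times> ('l list \<times> (cmap \<Rightarrow> 'v) \<times> (cmap \<Rightarrow> 'e)) \<times> cmap \<Rightarrow>
    'l shcell \<times> (cmap \<Rightarrow> 'w) \<times> (cmap \<Rightarrow> 'f)" where
  "cosk_image k0 k1 n = (\<lambda>(p, (w, f0, f1), g). (word_class n (p, w, g),
     (\<lambda>v. if hat_hom 0 n v then k0 (f0 (cmp 0 g v)) else undefined),
     (\<lambda>e. if hat_hom 1 n e then k1 (f1 (cmp 1 g e)) else undefined)))"

definition cosk_map :: "('v \<Rightarrow> 'w) \<Rightarrow> ('e \<Rightarrow> 'f) \<Rightarrow> nat \<Rightarrow>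
    (nat \<times> ('l list \<times> (cmap \<Rightarrow> 'v) \<times> (cmap \<Rightarrow> 'e)) \<times> cmap) set \<Rightarrow>
    'l shcell \<times> (cmap \<Rightarrow> 'w) \<times> (cmap \<Rightarrow> 'f)" where
  "cosk_map k0 k1 n C = cosk_image k0 k1 n (SOME r. r \<in> C)"

text \<open>The chosen representative does not matter: moving a box map from the cube to
  \<open>g\<close> changes neither the word class nor the composites.\<close>

lemma cosk_map_Lcls:
  "cosk_map k0 k1 n (Lcls (COSK ident p K) n r) = cosk_image k0 k1 n r"
proof -
  let ?X = "COSK ident p K"
  have "(SOME r'. r' \<in> Lcls ?X n r) \<in> Lcls ?X n r"
    by (rule someI[of _ r]) (simp add: Lcls_def)
  then have rel: "Lrel ?X n r (SOME r'. r' \<in> Lcls ?X n r)" by (simp add: Lcls_def)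
  have "cosk_image k0 k1 n r = cosk_image k0 k1 n (SOME r'. r' \<in> Lcls ?X n r)"
  proof (rule Lrel_invariant[OF _ rel])
    fix q q' d x g
    assume d: "box_hom q' q d" and x: "x \<in> cells ?X q" and g: "hat_hom n q' g"
    obtain w f0 f1 where x': "x = (w, f0, f1)" by (cases x)
    have "length w = q" using x by (auto simp: COSK_simps x' box_cosk_cells_def)
    then have "word_class n (q', nths w (free_coords q' q d), g) = word_class n (q, w, cmp n d g)"
      by (rule word_class_gen[OF d _ g])
    \<comment> \<open>The first conjunct discharges the guards in
      \<open>box_cosk_act\<close>.\<close>
    moreover have "box_hom k q' (cmp k g v) \<and> cmp k d (cmp k g v) = cmp k (cmp n d g) v"
      if "hat_hom k n v" "k \<le> 1" for k v
      using hat_box_low[OF hat_hom_cmp[OF that(1) g] that(2)] cmp_assoc[OF that(1)] by simp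
    ultimately show "cosk_image k0 k1 n (q', act ?X q' q d x, g) = cosk_image k0 k1 n (q, x, cmp n d g)"
      by (simp add: cosk_image_def COSK_simps(2) x' box_cosk_act_def cong: if_cong)
  qed
  then show ?thesis by (simp add: cosk_map_def)
qed

text \<open>The label condition holds because an edge of the word class carries the letter of
  \<open>w\<close> that remains free along that edge.\<close>

lemma cosk_image_cells:
  assumes iso: "oiso K K' k0 k1" and c: "(w, f0, f1) \<in> box_cosk_cells K q" and g: "hat_hom n q g"
  shows "cosk_image k0 k1 n (q, (w, f0, f1), g) \<in> cells (hat_cosk K') n"
proof -
  have w: "length w = q" using c by (auto simp: box_cosk_cells_def)
  have v: "k0 (f0 (cmp 0 g v)) \<in> oV K'" if "hat_hom 0 n v" for v
  proof -
    have "f0 (cmp 0 g v) \<in> oV K"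
      using c hat_box_low[OF hat_hom_cmp[OF that g]] by (auto simp: box_cosk_cells_def)
    then show ?thesis using iso bij_betwE unfolding oiso_def by metis
  qed
  have e: "k1 (f1 (cmp 1 g e)) \<in> oE K' \<and>
      src K' (k1 (f1 (cmp 1 g e))) = k0 (f0 (cmp 0 g (cmp 0 e (face 1 1 False)))) \<and>
      tgt K' (k1 (f1 (cmp 1 g e))) = k0 (f0 (cmp 0 g (cmp 0 e (face 1 1 True)))) \<and>
      act shLbang 1 n e (word_class n (q, w, g)) = sig1 (ell K' (k1 (f1 (cmp 1 g e))))"
    if e: "hat_hom 1 n e" for e
  proof -
    let ?e = "cmp 1 g e"
    have h: "hat_hom 1 q ?e" using hat_hom_cmp[OF e g] .
    have a: "cmp 0 ?e (face 1 1 b) = cmp 0 g (cmp 0 e (face 1 1 b))" for b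
      using cmp_assoc[OF box_hat[OF box_hom_face_1]] by blast
    have f: "f1 ?e \<in> oE K" "src K (f1 ?e) = f0 (cmp 0 g (cmp 0 e (face 1 1 False)))"
        "tgt K (f1 ?e) = f0 (cmp 0 g (cmp 0 e (face 1 1 True)))"
        "nths w (free_coords 1 q ?e) = [ell K (f1 ?e)]"
      using c hat_box_low[OF h] unfolding a[symmetric] by (auto simp: box_cosk_cells_def)
    have "act shLbang 1 n e (word_class n (q, w, g)) = sig1 (ell K (f1 ?e))"
      using act_word_class[OF w g e] word_class_edge[OF h w f(4)] by simp
    moreover have "k1 (f1 ?e) \<in> oE K'" using f(1) iso bij_betwE unfolding oiso_def by metis
    ultimately show ?thesis using f iso unfolding oiso_def by simp
  qed
  have "hat_hom 0 n (cmp 0 e (face 1 1 b))" if "hat_hom 1 n e" for e b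
    using hat_hom_cmp[OF box_hat[OF box_hom_face_1] that] .
  then show ?thesis
    using v e word_class_in_cells[OF w g] by (simp add: cosk_image_def hat_cosk_def hat_cosk_cells_def)
qed

lemma lmor_cosk_map:
  assumes iso: "oiso K K' k0 k1"
  shows "lmor (Llpsh (COSK ident p K)) (hat_cosk K') (cosk_map k0 k1)"
proof -
  let ?X = "COSK ident p K"
  have 1: "cosk_map k0 k1 n C \<in> cells (hat_cosk K') n \<and>
      lab (hat_cosk K') n (cosk_map k0 k1 n C) = lab (Llpsh ?X) n C"
    if C: "C \<in> cells (Llpsh ?X) n" for n C
  proof -
    obtain q x g where x: "x \<in> cells ?X q" "hat_hom n q g" "C = Lcls ?X n (q, x, g)"
      using C unfolding cells_Llpsh by blast
    obtain w f0 f1 where x': "x = (w, f0, f1)" by (cases x)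
    have "cosk_map k0 k1 n C = cosk_image k0 k1 n (q, (w, f0, f1), g)"
      by (simp add: x(3) x' cosk_map_Lcls)
    moreover have "lab (Llpsh ?X) n C = word_class n (q, w, g)"
      unfolding x(3) lab_Llpsh[OF bang_labelled_COSK] by (simp add: COSK_simps x')
    moreover have "lab (hat_cosk K') n (cosk_image k0 k1 n (q, (w, f0, f1), g)) = word_class n (q, w, g)"
      by (simp add: hat_cosk_def cosk_image_def)
    ultimately show ?thesis
      using cosk_image_cells[OF iso _ x(2), of w f0 f1] x(1) by (simp add: COSK_simps x')
  qed
  have 2: "cosk_map k0 k1 m (act (Llpsh ?X) m n h C) = act (hat_cosk K') m n h (cosk_map k0 k1 n C)"
    if h: "hat_hom m n h" and C: "C \<in> cells (Llpsh ?X) n" for m n h C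
  proof -
    obtain q x g where x: "x \<in> cells ?X q" "hat_hom n q g" "C = Lcls ?X n (q, x, g)"
      using C unfolding cells_Llpsh by blast
    obtain w f0 f1 where x': "x = (w, f0, f1)" by (cases x)
    have "length w = q" using x(1) by (auto simp: COSK_simps x' box_cosk_cells_def)
    then have "word_class m (q, w, cmp m g h) = act shLbang m n h (word_class n (q, w, g))"
      by (rule act_word_class[OF _ x(2) h, symmetric])
    moreover have "hat_hom k n (cmp k h v) \<and> cmp k (cmp m g h) v = cmp k g (cmp k h v)"
      if "hat_hom k m v" for k v
      using hat_hom_cmp[OF that h] cmp_assoc[OF that] by simp
    ultimately show ?thesis
      by (simp add: x(3) x' Lact_Lcls[OF h] cosk_map_Lcls cosk_image_def hat_cosk_def cong: if_cong)
  qed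
  show ?thesis unfolding lmor_def using 1 2 by blast
qed

text \<open>Injectivity of \<open>k0\<close> lets the vertices of the underlying cube, taken after
  \<open>g\<close>, be read off the image.\<close>

lemma cosk_image_vertex:
  assumes "oiso K K' k0 k1" "(w, f0, f1) \<in> box_cosk_cells K n" "hat_hom n n g" "length u = n"
    "v \<in> oV K" "fst (snd (cosk_image k0 k1 n (n, (w, f0, f1), g))) (pt u) = k0 v"
  shows "f0 (pt (g u)) = v"
proof -
  have "hat_hom 0 n (pt u)" using box_hom_0_pt box_hat assms(4) by blast
  then have "k0 (f0 (pt (g u))) = k0 v"
    using assms(6) by (simp add: cosk_image_def cmp_pt)
  moreover have "box_hom 0 n (pt (g u))" using box_hom_0_pt hat_hom_length[OF assms(3,4)] by blast
  then have "f0 (pt (g u)) \<in> oV K" using assms(2) by (auto simp: box_cosk_cells_def)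
  ultimately show ?thesis
    using assms(1,5) unfolding oiso_def bij_betw_def by (meson inj_onD)
qed

text \<open>Equal images give equal vertices after the two endomaps. From dimension 2 on,
  \<open>nontwisted_slots_unique\<close> separates list and endomap; below, both endomaps are
  identities. Vertices then determine the cubes.\<close>

lemma lmono_cosk_map:
  assumes iso: "oiso K K' k0 k1" and K: "osimple K" and ident: "inj_on ident (oV K)"
  shows "lmono (Llpsh (COSK ident p K)) (hat_cosk K') (cosk_map k0 k1)"
proof -
  let ?X = "COSK ident p K"
  have "C = C'" if C: "C \<in> cells (Llpsh ?X) n" and C': "C' \<in> cells (Llpsh ?X) n"
    and eq: "cosk_map k0 k1 n C = cosk_map k0 k1 n C'" for n C C'
  proof -
    obtain w f0 f1 g where c: "(w, f0, f1) \<in> box_cosk_cells K n" "hat_hom n n g"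
      "C = Lcls ?X n (n, (w, f0, f1), g)"
      "n \<le> 1 \<or> (\<exists>P. length P = p \<and> nontwisted_slots n P \<and> (\<forall>u. length u = n \<longrightarrow> ident (f0 (pt u)) = map (ev u) P))"
      using C by (rule cells_Llpsh_COSK_normal_form)
    obtain w' f0' f1' g' where c': "(w', f0', f1') \<in> box_cosk_cells K n" "hat_hom n n g'"
      "C' = Lcls ?X n (n, (w', f0', f1'), g')"
      "n \<le> 1 \<or> (\<exists>P. length P = p \<and> nontwisted_slots n P \<and> (\<forall>u. length u = n \<longrightarrow> ident (f0' (pt u)) = map (ev u) P))"
      using C' by (rule cells_Llpsh_COSK_normal_form)
    have V: "f0' (pt u) \<in> oV K" "f0 (pt u) \<in> oV K" if "length u = n" for u
      using c(1) c'(1) box_hom_0_pt[of n "pt u"] that by (auto simp: box_cosk_cells_def)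
    have img: "cosk_image k0 k1 n (n, (w, f0, f1), g) = cosk_image k0 k1 n (n, (w', f0', f1'), g')"
      using eq by (simp add: c(3) c'(3) cosk_map_Lcls)
    have gg': "f0 (pt (g u)) = f0' (pt (g' u))" if u: "length u = n" for u
    proof (rule cosk_image_vertex[OF iso c(1,2) u])
      show "f0' (pt (g' u)) \<in> oV K" using V(1) hat_hom_length[OF c'(2) u] .
      have "hat_hom 0 n (pt u)" using box_hom_0_pt box_hat u by blast
      then show "fst (snd (cosk_image k0 k1 n (n, (w, f0, f1), g))) (pt u) = k0 (f0' (pt (g' u)))"
        unfolding img by (simp add: cosk_image_def cmp_pt)
    qed
    have "g = g' \<and> (\<forall>u. length u = n \<longrightarrow> f0 (pt u) = f0' (pt u))"
    proof (cases "n \<le> 1")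
      case True
      then have "g = idm n" "g' = idm n" using hat_endo_low c(2) c'(2) by blast+
      then show ?thesis using gg' by (simp add: idm_def)
    next
      case False
      then obtain P P' where P: "nontwisted_slots n P" "\<And>u. length u = n \<Longrightarrow> ident (f0 (pt u)) = map (ev u) P"
        and P': "nontwisted_slots n P'" "\<And>u. length u = n \<Longrightarrow> ident (f0' (pt u)) = map (ev u) P'"
        using c(4) c'(4) by blast
      have "map (ev (g u)) P = map (ev (g' u)) P'" if u: "length u = n" for u
        using P(2)[OF hat_hom_length[OF c(2) u]] P'(2)[OF hat_hom_length[OF c'(2) u]] gg'[OF u] by simp
      then have *: "P = P' \<and> g = g'" by (rule nontwisted_slots_unique[OF P(1) P'(1) c(2) c'(2)])
      then have "ident (f0 (pt u)) = ident (f0' (pt u))" if "length u = n" for u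
        using P(2)[OF that] P'(2)[OF that] by simp
      then show ?thesis using * V inj_onD[OF ident] by metis
    qed
    then show ?thesis
      using box_cosk_cells_eqI[OF K c(1) c'(1)] c(3) c'(3) by simp
  qed
  then show ?thesis
    unfolding lmono_def using lmor_cosk_map[OF iso] by (blast intro: inj_onI)
qed

subsection \<open>Strictness\<close>

lemma finite_verts: "finite (verts n)"
  using finite_lists_length_eq[of "UNIV :: bool set" n] by (simp add: verts_def)

text \<open>With the label fixed, a cube is determined by its finite table of vertices. This
  prepares a counting argument.\<close>

lemma finite_hat_cosk_label:
  assumes K: "osimple K" and fin: "finite (oV K)"
  shows "finite {c \<in> cells (hat_cosk K) n. lab (hat_cosk K) n c = b}" (is "finite ?B")
proof -
  obtain us where us: "set us = verts n" using finite_list[OF finite_verts] by blast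
  define F where "F c = map (\<lambda>u. fst (snd c) (pt u)) us" for c :: "'c shcell \<times> (cmap \<Rightarrow> 'a) \<times> (cmap \<Rightarrow> 'b)"
  have hat0: "hat_hom 0 n v \<longleftrightarrow> (\<exists>u. length u = n \<and> v = pt u)" for v
    using hat_box_low[of 0 n v] box_hat[of 0 n v] box_hom_0_pt[of n v] by auto
  have "F ` ?B \<subseteq> {xs. set xs \<subseteq> oV K \<and> length xs = length us}"
  proof
    fix xs assume "xs \<in> F ` ?B"
    then obtain c f0 f1 where c: "(c, f0, f1) \<in> hat_cosk_cells K n" "xs = F (c, f0, f1)"
      by (auto simp: hat_cosk_def)
    then have "f0 (pt u) \<in> oV K" if "length u = n" for u
      using hat0[of "pt u"] that by (auto simp: hat_cosk_cells_def)
    then show "xs \<in> {xs. set xs \<subseteq> oV K \<and> length xs = length us}"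
      using us by (auto simp: c(2) F_def)
  qed
  then have "finite (F ` ?B)" using finite_lists_length_eq[OF fin] by (rule finite_subset)
  moreover have "inj_on F ?B"
  proof (rule inj_onI)
    fix c c' assume c: "c \<in> ?B" and c': "c' \<in> ?B" and eq: "F c = F c'"
    obtain f0 f1 where f: "c = (b, f0, f1)" "(b, f0, f1) \<in> hat_cosk_cells K n"
      using c by (cases c) (auto simp: hat_cosk_def)
    obtain h0 h1 where h: "c' = (b, h0, h1)" "(b, h0, h1) \<in> hat_cosk_cells K n"
      using c' by (cases c') (auto simp: hat_cosk_def)
    have "f0 (pt u) = h0 (pt u)" if "length u = n" for u
      using eq us that by (auto simp: F_def f(1) h(1))
    then have v: "f0 v = h0 v" for v
      using f(2) h(2) by (cases "hat_hom 0 n v") (auto simp: hat0 hat_cosk_cells_def)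
    have "f1 e = h1 e" for e
    proof (cases "hat_hom 1 n e")
      case True
      then have "f1 e \<in> oE K" "h1 e \<in> oE K" "src K (f1 e) = src K (h1 e)" "tgt K (f1 e) = tgt K (h1 e)"
        using f(2) h(2) v by (auto simp: hat_cosk_cells_def)
      then show ?thesis using K unfolding osimple_def by blast
    qed (use f(2) h(2) in \<open>auto simp: hat_cosk_cells_def\<close>)
    then show "c = c'" using v f(1) h(1) by (simp add: fun_eq_iff)
  qed
  ultimately show ?thesis by (rule finite_imageD)
qed

text \<open>An isomorphism forces equally many cubes over each label, and an injection between
  finite sets of equal size is onto. So one non-surjective monomorphism can rule out every
  isomorphism.\<close>

lemma liso_lmono_surj:
  assumes iso: "liso X Y \<phi>" and mono: "lmono X Y \<mu>"
    and fin: "finite {c \<in> cells Y n. lab Y n c = lab Y n z}" (is "finite ?B") and z: "z \<in> cells Y n"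
  obtains C where "C \<in> cells X n" "\<mu> n C = z"
proof -
  let ?A = "{C \<in> cells X n. lab X n C = lab Y n z}"
  have "inj_on (\<phi> n) (cells X n)" and im: "\<phi> n ` cells X n = cells Y n"
    and lab: "\<And>C. C \<in> cells X n \<Longrightarrow> lab Y n (\<phi> n C) = lab X n C"
    using iso by (auto simp: liso_def lmor_def bij_betw_def)
  moreover have "\<phi> n ` ?A = ?B"
    unfolding im[symmetric] using lab by auto
  ultimately have card: "card ?A = card ?B"
    using card_image[of "\<phi> n" ?A] inj_on_subset[of "\<phi> n" "cells X n" ?A] by auto
  have sub: "\<mu> n ` ?A \<subseteq> ?B" and "inj_on (\<mu> n) (cells X n)"
    using mono by (auto simp: lmono_def lmor_def)
  then have "card (\<mu> n ` ?A) = card ?A"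
    by (intro card_image) (auto intro: inj_on_subset)
  then have "\<mu> n ` ?A = ?B" using card_subset_eq[OF fin sub] card by simp
  moreover have "z \<in> ?B" using z by simp
  ultimately have "z \<in> \<mu> n ` ?A" by simp
  then show ?thesis using that by blast
qed

section \<open>Vertices of the product of two labelled cubes\<close>

lemma trunc_box_lcube_simps:
  "v \<in> oV (trunc_box (lcube as)) \<longleftrightarrow> box_hom 0 (length as) v"
  "e \<in> oE (trunc_box (lcube as)) \<longleftrightarrow> box_hom 1 (length as) e"
  "src (trunc_box (lcube as)) e = cmp 0 e (face 1 1 False)"
  "tgt (trunc_box (lcube as)) e = cmp 0 e (face 1 1 True)"
  "ell (trunc_box (lcube as)) e = hd (nths as (free_coords 1 (length as) e))"
  by (simp_all add: trunc_box_def)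

text \<open>All first components have length \<open>length as\<close>, so a concatenation splits
  uniquely.\<close>

lemma inj_on_vid:
  "inj_on vid (oV (fprod bar \<tau> (trunc_box (lcube as)) (trunc_box (lcube bs))))" (is "inj_on vid ?V")
proof (rule inj_onI)
  have pts: "\<exists>u v. x = (pt u, pt v) \<and> length u = length as" if "x \<in> ?V" for x
    using that unfolding fprod_simps mem_Times_iff trunc_box_lcube_simps box_hom_0_pt
    by (metis prod.collapse)
  fix x y assume "x \<in> ?V" "y \<in> ?V" and eq: "vid x = vid y"
  then obtain u v u' v' where "x = (pt u, pt v)" "y = (pt u', pt v')" "length u = length u'"
    using pts by metis
  then show "x = y" using eq by (simp add: vid_def)
qed

lemma finite_oV_fprod_lcube:
  "finite (oV (fprod bar \<tau> (trunc_box (lcube as)) (trunc_box (lcube bs))))"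
proof -
  have "cells (lcube cs) 0 = pt ` verts (length cs)" for cs :: "'a list"
    by (auto simp: box_hom_0_pt)
  then show ?thesis by (simp add: fprod_simps trunc_box_def finite_verts)
qed

text \<open>This sorts the two coordinates. It identifies the two middle vertices:
  adjacency-preserving maps need not be injective.\<close>

definition maxmin :: cmap where
  "maxmin x = (if length x = 2 then [x ! 0 \<or> x ! 1, x ! 0 \<and> x ! 1] else [])"

lemma hamming_pair: "hamming [a, b] [c, d] = (if a = c then 0 else 1) + (if b = d then 0 else 1)"
proof -
  have "{i. i < length [a, b] \<and> [a, b] ! i \<noteq> [c, d] ! i} =
      (if a = c then {} else {0}) \<union> (if b = d then {} else {1})"
    by (auto simp: less_Suc_eq)
  then show ?thesis by (auto simp: hamming_def)
qed

lemma leq_pair: "leq [a, b] [c, d] \<longleftrightarrow> (a \<longrightarrow> c) \<and> (b \<longrightarrow> d)"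
  by (auto simp: leq_def All_less_Suc)

lemma hat_hom_maxmin: "hat_hom 2 2 maxmin"
proof -
  have pair: "\<exists>a b. x = [a, b]" if "length x = 2" for x :: vert
    using that by (auto simp: numeral_2_eq_2 length_Suc_conv)
  have m: "maxmin [a, b] = [a \<or> b, a \<and> b]" for a b by (simp add: maxmin_def)
  have "leq (maxmin x) (maxmin y) \<and> maxmin x \<noteq> maxmin y"
    if "length x = 2" "length y = 2" "leq x y \<and> x \<noteq> y" for x y
    using pair[OF that(1)] pair[OF that(2)] that(3) by (auto simp: m leq_pair)
  moreover have "hamming (maxmin x) (maxmin y) = 1"
    if "length x = 2" "length y = 2" "hamming x y = 1" for x y
    using pair[OF that(1)] pair[OF that(2)] that(3) by (auto simp: m hamming_pair split: if_splits)
  ultimately show ?thesis by (simp add: hat_hom_def is_map_def) (simp add: maxmin_def)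
qed

text \<open>Equal letters make the label independent of the direction of the edge, which
  \<open>maxmin\<close> may change.\<close>

lemma nths_repeated_label:
  assumes "box_hom 1 2 e" shows "nths [a, a] (free_coords 1 2 e) = [a]"
proof -
  have "length (nths [a, a] (free_coords 1 2 e)) = 1"
    using length_nths_free_coords[OF assms, of "[a, a]"] by simp
  moreover have "set (nths [a, a] (free_coords 1 2 e)) \<subseteq> {a}"
    using set_nths_subset[of "[a, a]"] by auto
  ultimately show ?thesis by (cases "nths [a, a] (free_coords 1 2 e)") auto
qed

text \<open>Each edge \<open>e\<close> is synchronised with its image under \<open>maxmin\<close>;
  their labels are \<open>a\<close> and \<open>bar a\<close>, so every edge of the square has label
  \<tau>.\<close>

lemma maxmin_square:
  assumes "a \<noteq> \<tau>"
  shows "([\<tau>, \<tau>], \<lambda>v. if box_hom 0 2 v then (v, cmp 0 maxmin v) else undefined,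
      \<lambda>e. if box_hom 1 2 e then ES e (cmp 1 maxmin e) else undefined)
    \<in> box_cosk_cells (fprod bar \<tau> (trunc_box (lcube [a, a])) (trunc_box (lcube [bar a, bar a]))) 2"
proof -
  let ?K = "fprod bar \<tau> (trunc_box (lcube [a, a])) (trunc_box (lcube [bar a, bar a]))"
  have len: "length [c, c] = 2" for c :: 'a by simp
  have box: "box_hom k 2 (cmp k maxmin v)" if "box_hom k 2 v" "k \<le> 1" for k v
    using hat_box_low[OF hat_hom_cmp[OF box_hat[OF that(1)] hat_hom_maxmin] that(2)] .
  have V: "(v, cmp 0 maxmin v) \<in> oV ?K" if "box_hom 0 2 v" for v
    using that box[OF that] unfolding fprod_simps mem_Times_iff trunc_box_lcube_simps len by simp
  have E: "ES e (cmp 1 maxmin e) \<in> oE ?K"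
      "src ?K (ES e (cmp 1 maxmin e)) = (cmp 0 e (face 1 1 False), cmp 0 maxmin (cmp 0 e (face 1 1 False)))"
      "tgt ?K (ES e (cmp 1 maxmin e)) = (cmp 0 e (face 1 1 True), cmp 0 maxmin (cmp 0 e (face 1 1 True)))"
      "[ell ?K (ES e (cmp 1 maxmin e))] = nths [\<tau>, \<tau>] (free_coords 1 2 e)"
      "box_hom 0 2 (cmp 0 e (face 1 1 c))"
    if e: "box_hom 1 2 e" for e c
  proof -
    have me: "box_hom 1 2 (cmp 1 maxmin e)" using box[OF e] by simp
    show "ES e (cmp 1 maxmin e) \<in> oE ?K"
      using e me assms
      unfolding fprod_edges trunc_box_lcube_simps len nths_repeated_label[OF e] nths_repeated_label[OF me]
      by simp
    have "cmp 0 (cmp 1 maxmin e) (face 1 1 c) = cmp 0 maxmin (cmp 0 e (face 1 1 c))" for c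
      by (rule cmp_assoc[OF box_hat[OF box_hom_face_1]])
    then show "src ?K (ES e (cmp 1 maxmin e)) = (cmp 0 e (face 1 1 False), cmp 0 maxmin (cmp 0 e (face 1 1 False)))"
      "tgt ?K (ES e (cmp 1 maxmin e)) = (cmp 0 e (face 1 1 True), cmp 0 maxmin (cmp 0 e (face 1 1 True)))"
      unfolding fprod_simps trunc_box_lcube_simps by simp_all
    show "[ell ?K (ES e (cmp 1 maxmin e))] = nths [\<tau>, \<tau>] (free_coords 1 2 e)"
      unfolding fprod_simps nths_repeated_label[OF e] ..
    show "box_hom 0 2 (cmp 0 e (face 1 1 c))" using box_hom_cmp[OF box_hom_face_1 e] .
  qed
  show ?thesis
    unfolding box_cosk_cells_def mem_Collect_eq prod.case len using V E by simp
qed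

text \<open>The square \<open>u \<mapsto> (u, maxmin u)\<close>, all of whose edges are synchronisations, has four distinct
  coordinate functions, while a square of the left-hand side has at most two non-constant ones.\<close>
lemma not_liso_lcube_pair:
  fixes bar :: "'l \<Rightarrow> 'l"
  assumes "a \<noteq> \<tau>"
  shows "\<not> liso (lhs8p5 bar \<tau> [a, a] [bar a, bar a]) (rhs8p5 bar \<tau> [a, a] [bar a, bar a]) \<phi>"
proof
  assume liso: "liso (lhs8p5 bar \<tau> [a, a] [bar a, bar a]) (rhs8p5 bar \<tau> [a, a] [bar a, bar a]) \<phi>"
  let ?K = "fprod bar \<tau> (trunc_box (lcube [a, a])) (trunc_box (lcube [bar a, bar a]))"
  let ?K' = "fprod bar \<tau> (trunc_hat (Llpsh (lcube [a, a]))) (trunc_hat (Llpsh (lcube [bar a, bar a])))"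
  obtain k0 k1 where iso: "oiso ?K ?K' k0 k1"
    by (rule that[OF oiso_fprod[OF oiso_lcube oiso_lcube]])
  have K: "osimple ?K" by (intro osimple_fprod osimple_lcube)
  have "bij_betw k0 (oV ?K) (oV ?K')" using iso unfolding oiso_def by (rule conjunct1)
  then have fin: "finite (oV ?K')" using bij_betw_finite finite_oV_fprod_lcube by metis
  let ?X = "Llpsh (COSK vid 4 ?K)"
  have mono: "lmono ?X (hat_cosk ?K') (cosk_map k0 k1)"
    using lmono_cosk_map[OF iso K inj_on_vid] .
  have liso': "liso ?X (hat_cosk ?K') \<phi>" using liso by (simp add: lhs8p5_def rhs8p5_def numeral_eq_Suc)
  define f0 where "f0 v = (if box_hom 0 2 v then (v, cmp 0 maxmin v) else undefined)" for v
  define f1 :: "cmap \<Rightarrow> (cmap, cmap, cmap, cmap) pedge" where "f1 e = (if box_hom 1 2 e then ES e (cmp 1 maxmin e) else undefined)" for e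
  have cell: "([\<tau>, \<tau>], f0, f1) \<in> box_cosk_cells ?K 2"
    unfolding f0_def f1_def by (rule maxmin_square[OF assms])
  \<comment> \<open>\<open>z\<close> is the image of the square with the identity endomap;
    \<open>cosk_image_cells\<close> applies to any cube of the coskeleton, twisted or not.\<close>
  define z where "z = cosk_image k0 k1 2 (2, ([\<tau>, \<tau>], f0, f1), idm 2)"
  have "z \<in> cells (hat_cosk ?K') 2"
    unfolding z_def by (rule cosk_image_cells[OF iso cell hat_hom_idm])
  \<comment> \<open>Counting makes the comparison map surjective over the label of \<open>z\<close>,
    whatever \<phi> is.\<close>
  then obtain C where C: "C \<in> cells ?X 2" "cosk_map k0 k1 2 C = z"
    by (rule liso_lmono_surj[OF liso' mono finite_hat_cosk_label[OF oiso_osimple[OF iso K] fin]])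
  obtain w h0 h1 g where c: "(w, h0, h1) \<in> box_cosk_cells ?K 2" "hat_hom 2 2 g"
      "C = Lcls (COSK vid 4 ?K) 2 (2, (w, h0, h1), g)"
      "(2::nat) \<le> 1 \<or> (\<exists>P. length P = 4 \<and> nontwisted_slots 2 P \<and> (\<forall>u. length u = 2 \<longrightarrow> vid (h0 (pt u)) = map (ev u) P))"
    using C(1) by (rule cells_Llpsh_COSK_normal_form)
  then obtain P where P: "length P = 4" "nontwisted_slots 2 P" "\<And>u. length u = 2 \<Longrightarrow> vid (h0 (pt u)) = map (ev u) P"
    by auto
  have val: "map (ev (g u)) P = u @ maxmin u" if u: "length u = 2" for u
  proof -
    have pt: "box_hom 0 2 (pt u)" using u box_hom_0_pt by blast
    have "h0 (pt (g u)) = f0 (pt u)"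
    proof (rule cosk_image_vertex[OF iso c(1,2) u])
      show "f0 (pt u) \<in> oV ?K" using cell pt by (auto simp: box_cosk_cells_def)
      have "cmp 0 (idm 2) (pt u) = pt u" using u by (simp add: cmp_pt idm_def)
      then have "fst (snd z) (pt u) = k0 (f0 (pt u))"
        using box_hat[OF pt] by (simp add: z_def cosk_image_def)
      then show "fst (snd (cosk_image k0 k1 2 (2, (w, h0, h1), g))) (pt u) = k0 (f0 (pt u))"
        using C(2) by (simp add: c(3) cosk_map_Lcls)
    qed
    then show ?thesis
      using P(3)[OF hat_hom_length[OF c(2) u]] pt by (simp add: f0_def vid_def cmp_pt)
  qed
  \<comment> \<open>After \<open>g\<close>, the four slots of \<open>P\<close> must produce both
    coordinates, their join and their meet.\<close>
  have ev: "ev (g [x, y]) (P ! k) = [x, y, x \<or> y, x \<and> y] ! k" if "k < 4" for x y k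
    using arg_cong[OF val[of "[x, y]"], of "\<lambda>l. l ! k"] that P(1) by (simp add: maxmin_def)
  \<comment> \<open>All four entries change between bottom and top, so no slot is constant.\<close>
  have crd: "\<exists>i<2. P ! k = Crd i" if "k < 4" for k
  proof (cases "P ! k")
    case (Cst c)
    then have "[False, False, False, False] ! k = [True, True, True, True] ! k"
      using ev[OF that, of False False] ev[OF that, of True True] by simp
    then show ?thesis using that by (auto simp: less_Suc_eq numeral_eq_Suc)
  next
    case (Crd i)
    then have "i < 2" using P(1,2) that nth_mem[of k P] unfolding nontwisted_slots_def by metis
    then show ?thesis using Crd by blast
  qed
  obtain i0 i2 i3 where i: "i0 < 2" "i2 < 2" "i3 < 2" "P ! 0 = Crd i0" "P ! 2 = Crd i2" "P ! 3 = Crd i3"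
    using crd[of 0] crd[of 2] crd[of 3] by auto
  \<comment> \<open>The first coordinate, the join and the meet differ pairwise on one of the two
    middle vertices, yet only two indices are available.\<close>
  have "i0 \<noteq> i2" "i0 \<noteq> i3" "i2 \<noteq> i3"
    using ev[of 0 False True] ev[of 0 True False] ev[of 2 False True] ev[of 2 True False]
      ev[of 3 False True] ev[of 3 True False] i by auto
  then show False using i by linarith
qed

theorem theorem8p5:
  fixes \<tau> :: 'l and bar :: "'l \<Rightarrow> 'l"
  assumes "\<forall>a. a \<noteq> \<tau> \<longrightarrow> bar a \<noteq> \<tau> \<and> bar (bar a) = a"
  shows "(\<forall>as bs :: 'l list. \<exists>\<phi>. lmono (lhs8p5 bar \<tau> as bs) (rhs8p5 bar \<tau> as bs) \<phi>)
       \<and> ((\<exists>a. a \<noteq> \<tau>) \<longrightarrow>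
           (\<exists>as bs :: 'l list. \<not> (\<exists>\<phi>. liso (lhs8p5 bar \<tau> as bs) (rhs8p5 bar \<tau> as bs) \<phi>)))"
proof (intro conjI allI impI)
  show "\<exists>\<phi>. lmono (lhs8p5 bar \<tau> as bs) (rhs8p5 bar \<tau> as bs) \<phi>" for as bs
    unfolding lhs8p5_def rhs8p5_def
    by (rule exI, rule lmono_cosk_map[OF oiso_fprod[OF oiso_lcube oiso_lcube] _ inj_on_vid])
       (intro osimple_fprod osimple_lcube)
next
  assume "\<exists>a. a \<noteq> \<tau>"
  then obtain a where a: "a \<noteq> \<tau>" ..
  show "\<exists>as bs. \<not> (\<exists>\<phi>. liso (lhs8p5 bar \<tau> as bs) (rhs8p5 bar \<tau> as bs) \<phi>)"
  \<comment> \<open>The witnesses repeat one letter so that labels ignore directions, and pair it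
    with its conjugate so that edges synchronise.\<close>
  proof (intro exI notI)
    assume "\<exists>\<phi>. liso (lhs8p5 bar \<tau> [a, a] [bar a, bar a]) (rhs8p5 bar \<tau> [a, a] [bar a, bar a]) \<phi>"
    then show False by (elim exE not_liso_lcube_pair[OF a, THEN notE])
  qed
qed

end
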